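(* Let $D$ be a 2-strong digraph of order $n\geq 3$ satisfying condition $(M)$, i.e. $d(x)+d(y)+d(w)+d(z)\geq 4n-3$ for all distinct pairs $\{x,y\}\neq\{w,z\}$ of non-adjacent vertices of $D$. Then $D$ is Hamiltonian.
   Context: Digraphs are finite, without loops and multiple arcs. For a vertex $x$, $d^+(x)$ and $d^-(x)$ are its out-degree and in-degree and $d(x)=d^+(x)+d^-(x)$. Two distinct vertices $x,y$ are adjacent if $xy\in A(D)$ or $yx\in A(D)$. A digraph $D$ is $k$-strong if $|V(D)|\geq k+1$ and $D$ minus any set of at most $k-1$ vertices is strongly connected. $D$ is Hamiltonian if it contains a (directed) cycle through all its vertices. *)

theory Defs
  imports "Graph_Theory.Graph_Theory"
begin

definition degree :: "('a, 'b) pre_digraph \<Rightarrow> 'a \<Rightarrow> nat" where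
  "degree D x = out_degree D x + in_degree D x"

definition adjacent :: "('a, 'b) pre_digraph \<Rightarrow> 'a \<Rightarrow> 'a \<Rightarrow> bool" where
  "adjacent D x y \<longleftrightarrow> x \<noteq> y \<and> (x \<rightarrow>\<^bsub>D\<^esub> y \<or> y \<rightarrow>\<^bsub>D\<^esub> x)"

definition nonadjacent_pair :: "('a, 'b) pre_digraph \<Rightarrow> 'a \<Rightarrow> 'a \<Rightarrow> bool" where
  "nonadjacent_pair D x y \<longleftrightarrow>
     x \<in> verts D \<and> y \<in> verts D \<and> x \<noteq> y \<and> \<not> adjacent D x y"

definition k_strong :: "nat \<Rightarrow> ('a, 'b) pre_digraph \<Rightarrow> bool" where
  "k_strong k D \<longleftrightarrow>
     card (verts D) \<ge> k + 1 \<and>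
     (\<forall>S \<subseteq> verts D. card S < k \<longrightarrow> strongly_connected (D \<restriction> (verts D - S)))"

text \<open>
  The two pairs are distinct as unordered pairs, so they may share one vertex.
  The subtraction on the naturals truncates only for a digraph without vertices,
  where there are no pairs to consider.
\<close>

definition condition_M :: "('a, 'b) pre_digraph \<Rightarrow> bool" where
  "condition_M D \<longleftrightarrow>
     (\<forall>x y w z. nonadjacent_pair D x y \<and> nonadjacent_pair D w z \<and> {x, y} \<noteq> {w, z} \<longrightarrow>
        degree D x + degree D y + degree D w + degree D z \<ge> 4 * card (verts D) - 3)"

text \<open>
  A cycle is a nonempty list of arcs, and the vertices visited by a nonempty arc list
  do not depend on the first argument of \<^const>\<open>pre_digraph.awalk_verts\<close>.
\<close>

definition hamiltonian :: "('a, 'b) pre_digraph \<Rightarrow> bool" where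
  "hamiltonian D \<longleftrightarrow>
     (\<exists>u p. pre_digraph.cycle D p \<and> set (pre_digraph.awalk_verts D u p) = verts D)"

end

theory Submission
  imports Defs "HOL-Library.Sublist"
begin

text \<open>
  Call a non-adjacent pair bad if its degree sum is at most \<open>2n - 2\<close>. By condition (M) there is at most one
  bad pair, and the smaller its degree sum, the larger the degree sums of all other pairs.

  Suppose \<open>D\<close> is not Hamiltonian. The argument of Bondy and Thomassen for Meyniel's theorem (a longest cycle, a
  bypass with the shortest possible gap, and insertion of the vertices of the gap into the rest of the cycle)
  produces a bad pair \<open>a, b\<close> with \<open>a\<close> off the cycle and \<open>b\<close> on it. Applied again to \<open>D - a\<close>, it shows
  that the cycle misses only \<open>a\<close>, and inserting the gap vertices yields a path through
  \<open>V - {a, b}\<close> that is closed up to a cycle by \<open>a\<close>.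

  On every such path all out-neighbours of the other vertex of the pair precede all its in-neighbours; otherwise
  the insertion argument gives a second bad pair. Hence few vertices are non-adjacent to \<open>a\<close> or \<open>b\<close>, and
  these have such large degree that they can be inserted into any path or cycle through all the other vertices,
  so they may be dropped at will. Using this freedom the path \<open>Q\<close> is chosen so that both \<open>a\<close> and \<open>b\<close> close
  it. By 2-strength some arc jumps over each inner vertex of \<open>Q\<close>. Chaining such arcs gives two disjoint
  paths, each from the out-neighbours to the in-neighbours of \<open>a\<close> and \<open>b\<close>, which together with \<open>a\<close> and
  \<open>b\<close> form a cycle through all vertices that are not insertable.
\<close>

section \<open>Paths, cycles and insertion\<close>

definition dpath :: "('v \<Rightarrow> 'v \<Rightarrow> bool) \<Rightarrow> 'v list \<Rightarrow> bool" where
  "dpath E xs \<longleftrightarrow> successively E xs \<and> distinct xs"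

definition dcycle :: "('v \<Rightarrow> 'v \<Rightarrow> bool) \<Rightarrow> 'v list \<Rightarrow> bool" where
  "dcycle E xs \<longleftrightarrow> xs \<noteq> [] \<and> dpath E xs \<and> E (last xs) (hd xs)"

definition deg_in :: "('v \<Rightarrow> 'v \<Rightarrow> bool) \<Rightarrow> 'v set \<Rightarrow> 'v \<Rightarrow> nat" where
  "deg_in E S x = card {z \<in> S. E x z} + card {z \<in> S. E z x}"

lemma dpath_append:
  "dpath E (xs @ ys) \<longleftrightarrow> dpath E xs \<and> dpath E ys \<and> set xs \<inter> set ys = {} \<and>
     (xs \<noteq> [] \<and> ys \<noteq> [] \<longrightarrow> E (last xs) (hd ys))"
  by (auto simp: dpath_def successively_append_iff)

lemma dpath_Nil [simp]: "dpath E []"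
  and dpath_single [simp]: "dpath E [x]"
  by (auto simp: dpath_def)

lemma dpath_Cons:
  "dpath E (x # xs) \<longleftrightarrow> dpath E xs \<and> x \<notin> set xs \<and> (xs \<noteq> [] \<longrightarrow> E x (hd xs))"
  by (auto simp: dpath_def successively_Cons)

lemma dcycle_rotate: "dcycle E (xs @ ys) \<Longrightarrow> dcycle E (ys @ xs)"
  by (cases "xs = []"; cases "ys = []") (auto simp: dcycle_def dpath_append)

lemma deg_in_union:
  assumes "finite A" "finite B" "A \<inter> B = {}"
  shows "deg_in E (A \<union> B) x = deg_in E A x + deg_in E B x"
proof -
  have "{z \<in> A \<union> B. E x z} = {z \<in> A. E x z} \<union> {z \<in> B. E x z}"
    "{z \<in> A \<union> B. E z x} = {z \<in> A. E z x} \<union> {z \<in> B. E z x}" by auto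
  moreover have "card ({z \<in> A. E x z} \<union> {z \<in> B. E x z}) = card {z \<in> A. E x z} + card {z \<in> B. E x z}"
    "card ({z \<in> A. E z x} \<union> {z \<in> B. E z x}) = card {z \<in> A. E z x} + card {z \<in> B. E z x}"
    using assms by (auto intro!: card_Un_disjoint)
  ultimately show ?thesis by (simp add: deg_in_def)
qed

lemma deg_in_single: "deg_in E {z} x = (if E x z then 1 else 0) + (if E z x then 1 else 0)"
proof -
  have "{w \<in> {z}. E x w} = (if E x z then {z} else {})" "{w \<in> {z}. E w x} = (if E z x then {z} else {})"
    by auto
  then show ?thesis by (simp add: deg_in_def)
qed

lemma deg_in_empty [simp]: "deg_in E {} x = 0"
  by (simp add: deg_in_def)

lemma deg_in_insert:
  assumes "finite A" "z \<notin> A"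
  shows "deg_in E (insert z A) x = deg_in E A x + (if E x z then 1 else 0) + (if E z x then 1 else 0)"
  using deg_in_union[of A "{z}" E x] assms by (simp add: deg_in_single)

lemma deg_in_le: "finite A \<Longrightarrow> deg_in E A x \<le> 2 * card A"
  unfolding deg_in_def
  by (metis (no_types, lifting) add_mono card_mono mem_Collect_eq mult_2 subsetI)

lemma deg_in_eq_0: "(\<And>z. z \<in> A \<Longrightarrow> \<not> E x z \<and> \<not> E z x) \<Longrightarrow> deg_in E A x = 0"
proof -
  assume "\<And>z. z \<in> A \<Longrightarrow> \<not> E x z \<and> \<not> E z x"
  then have "{z \<in> A. E x z} = {}" "{z \<in> A. E z x} = {}" by auto
  then show ?thesis by (simp only: deg_in_def card.empty)
qed

lemma deg_in_converse: "deg_in (\<lambda>x y. E y x) S x = deg_in E S x"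
  by (simp add: deg_in_def)

text \<open>At most one of \<open>E x z\<close> and \<open>E z y\<close> holds, and at most one of
  \<open>E y z\<close> and \<open>E z x\<close>, so each \<open>z\<close> contributes at most
  2.\<close>

lemma deg_in_pair_le:
  assumes "finite A" "\<And>z. z \<in> A \<Longrightarrow> \<not> (E x z \<and> E z y) \<and> \<not> (E y z \<and> E z x)"
  shows "deg_in E A x + deg_in E A y \<le> 2 * card A"
  using assms
proof (induction A rule: finite_induct)
  case (insert z A)
  then have "deg_in E A x + deg_in E A y \<le> 2 * card A" by auto
  moreover have "\<not> (E x z \<and> E z y) \<and> \<not> (E y z \<and> E z x)" using insert.prems by auto
  ultimately show ?case using insert.hyps by (auto simp: deg_in_insert)
qed simp

text \<open>For consecutive path vertices \<open>u\<close>, \<open>v\<close> at most one of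
  \<open>E u t\<close>, \<open>E t v\<close> holds; only the arc from \<open>t\<close> to the first
  vertex and the arc from the last vertex to \<open>t\<close> escape this count. The conditional
  term keeps track of the latter, so that the induction can append a vertex.\<close>

lemma deg_in_path_le:
  assumes "distinct xs" "xs \<noteq> []"
    and "\<And>ys zs. xs = ys @ zs \<Longrightarrow> ys \<noteq> [] \<Longrightarrow> zs \<noteq> [] \<Longrightarrow> \<not> (E (last ys) t \<and> E t (hd zs))"
  shows "deg_in E (set xs) t + (if E (last xs) t then 0 else 1) \<le> length xs + 1"
  using assms
proof (induction xs rule: rev_induct)
  case (snoc v xs)
  show ?case
  proof (cases "xs = []")
    case True
    then show ?thesis by (simp add: deg_in_single)
  next
    case False
    have IH: "deg_in E (set xs) t + (if E (last xs) t then 0 else 1) \<le> length xs + 1"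
    proof (rule snoc.IH)
      show "distinct xs" using snoc.prems by simp
      show "xs \<noteq> []" by fact
      fix ys zs assume "xs = ys @ zs" "ys \<noteq> []" "zs \<noteq> []"
      then show "\<not> (E (last ys) t \<and> E t (hd zs))" using snoc.prems(3)[of ys "zs @ [v]"] by simp
    qed
    have "\<not> (E (last xs) t \<and> E t v)" using snoc.prems(3)[of xs "[v]"] False by simp
    moreover have "deg_in E (set (xs @ [v])) t
        = deg_in E (set xs) t + (if E t v then 1 else 0) + (if E v t then 1 else 0)"
      using snoc.prems(1) by (simp add: deg_in_insert)
    ultimately show ?thesis using IH by (auto split: if_splits)
  qed
qed simp

lemma insertion_point:
  assumes "distinct xs" "deg_in E (set xs) t \<ge> length xs + 2"
  obtains ys zs where "xs = ys @ zs" "ys \<noteq> []" "zs \<noteq> []" "E (last ys) t" "E t (hd zs)"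
proof -
  have "xs \<noteq> []" using assms(2) by auto
  show ?thesis
  proof (rule ccontr)
    assume "\<not> thesis"
    then have "deg_in E (set xs) t + (if E (last xs) t then 0 else 1) \<le> length xs + 1"
      using that assms(1) \<open>xs \<noteq> []\<close> by (intro deg_in_path_le) blast+
    then show False using assms(2) by auto
  qed
qed

lemma dpath_insert:
  assumes "dpath E (ys @ zs)" "ys \<noteq> []" "zs \<noteq> []" "E (last ys) t" "E t (hd zs)" "t \<notin> set (ys @ zs)"
  shows "dpath E (ys @ t # zs)"
  using assms by (auto simp: dpath_append dpath_Cons)

text \<open>Vertices with large degree into the current path are inserted one at a time, always
  between two path vertices. Hence the ends and the order of the old vertices survive, and every
  vertex left over has small degree into the final path.\<close>

lemma maximal_insertion:
  assumes "dpath E P" "P \<noteq> []" "finite T" "T \<inter> set P = {}"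
  shows "\<exists>Q T'. T' \<subseteq> T \<and> dpath E Q \<and> Q \<noteq> [] \<and> set Q = set P \<union> T' \<and> hd Q = hd P \<and> last Q = last P
    \<and> subseq P Q \<and> (\<forall>y\<in>T - T'. deg_in E (set Q) y \<le> length Q + 1)"
  using assms
proof (induction "card T" arbitrary: T P)
  case 0
  then show ?case by (intro exI[of _ P] exI[of _ "{}"]) auto
next
  case (Suc k)
  show ?case
  proof (cases "\<exists>y\<in>T. deg_in E (set P) y \<ge> length P + 2")
    case False
    then show ?thesis using Suc.prems by (intro exI[of _ P] exI[of _ "{}"]) (auto simp: not_le)
  next
    case True
    then obtain y where y: "y \<in> T" "deg_in E (set P) y \<ge> length P + 2" by auto
    then obtain ys zs where p: "P = ys @ zs" "ys \<noteq> []" "zs \<noteq> []" "E (last ys) y" "E y (hd zs)"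
      using insertion_point[of P E y] Suc.prems by (auto simp: dpath_def)
    let ?P = "ys @ y # zs"
    have "k = card (T - {y})" using Suc.hyps(2) y(1) Suc.prems(3) by simp
    moreover have "dpath E ?P" using p Suc.prems y by (intro dpath_insert) auto
    moreover have "(T - {y}) \<inter> set ?P = {}" using p Suc.prems by auto
    ultimately obtain Q T' where Q: "T' \<subseteq> T - {y}" "dpath E Q" "Q \<noteq> []" "set Q = set ?P \<union> T'"
      "hd Q = hd ?P" "last Q = last ?P" "subseq ?P Q"
      "\<forall>z\<in>T - {y} - T'. deg_in E (set Q) z \<le> length Q + 1"
      using Suc.hyps(1)[of "T - {y}" ?P] Suc.prems by auto
    have "subseq P ?P" unfolding p(1) by (intro list_emb_append_mono) auto
    then have "subseq P Q" using Q(7) by (rule subseq_order.trans)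
    then show ?thesis
      using Q y p by (intro exI[of _ Q] exI[of _ "insert y T'"]) auto
  qed
qed

lemma subseq_pairD: "subseq [x, y] R \<Longrightarrow> \<exists>us vs ws. R = us @ x # vs @ y # ws"
  by (auto dest!: list_emb_ConsD)

lemma subseq_pairI: "x \<in> set A \<Longrightarrow> y \<in> set B \<Longrightarrow> subseq [x, y] (A @ B)"
  using list_emb_append_mono[of "(=)" "[x]" A "[y]" B] by (simp add: subseq_singleton_left)

section \<open>Digraphs as relations on a finite vertex set\<close>

locale rel_digraph =
  fixes V :: "'v set" and E :: "'v \<Rightarrow> 'v \<Rightarrow> bool"
  assumes finite_V: "finite V"
    and E_in: "E x y \<Longrightarrow> x \<in> V \<and> y \<in> V"
    and E_irrefl: "\<not> E x x"
begin

definition nonadj :: "'v \<Rightarrow> 'v \<Rightarrow> bool" where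
  "nonadj x y \<longleftrightarrow> x \<in> V \<and> y \<in> V \<and> x \<noteq> y \<and> \<not> E x y \<and> \<not> E y x"

abbreviation dg :: "'v \<Rightarrow> nat" where "dg \<equiv> deg_in E V"

text \<open>Strong connectivity of the subdigraph induced by \<open>U\<close>, in the form in which it is used.\<close>

definition out_closed_free :: "'v set \<Rightarrow> bool" where
  "out_closed_free U \<longleftrightarrow> (\<forall>S. S \<subseteq> U \<and> S \<noteq> {} \<and> S \<noteq> U \<longrightarrow> (\<exists>x\<in>S. \<exists>y\<in>U - S. E x y))"

text \<open>The cycle is \<open>L @ T\<close>, and \<open>P\<close> leads from the end of \<open>L\<close> back to its start, avoiding the gap \<open>T\<close>.
  If \<open>L\<close> is a single vertex, \<open>P\<close> is a closed detour at that vertex; this makes bypasses available without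
  2-strength.\<close>

definition bypass :: "'v set \<Rightarrow> nat \<Rightarrow> 'v list \<Rightarrow> 'v list \<Rightarrow> 'v list \<Rightarrow> bool" where
  "bypass U m L T P \<longleftrightarrow> dcycle E (L @ T) \<and> L \<noteq> [] \<and> P \<noteq> [] \<and> dpath E P \<and> set (L @ T) \<subseteq> U \<and> set P \<subseteq> U
     \<and> set P \<inter> set (L @ T) = {} \<and> length (L @ T) = m \<and> E (last L) (hd P) \<and> E (last P) (hd L)"

text \<open>An arc leaves \<open>C\<close> at \<open>x\<close>, and a path outside \<open>C\<close>
  leads on to an arc returning to \<open>C\<close> at \<open>v\<close>. Exit and return may
  coincide, which makes \<open>L\<close> a single vertex.\<close>

lemma bypass_exists:
  assumes "out_closed_free U" "dcycle E C" "set C \<subset> U"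
  shows "\<exists>L T P. bypass U (length C) L T P"
proof -
  have "set C \<noteq> {}" using assms(2) by (auto simp: dcycle_def)
  then obtain x z where xz: "x \<in> set C" "z \<in> U - set C" "E x z"
    using assms(1,3) unfolding out_closed_free_def by blast
  \<comment> \<open>The vertices reachable from \<open>z\<close> outside \<open>C\<close>; an arc
    leaving this set inside \<open>U\<close> must end on \<open>C\<close>, as the path could be
    prolonged otherwise.\<close>
  define S where "S = {w. \<exists>P. dpath E P \<and> P \<noteq> [] \<and> hd P = z \<and> last P = w \<and> set P \<subseteq> U - set C}"
  have "z \<in> S" unfolding S_def using xz by (auto intro!: exI[of _ "[z]"])
  have "S \<subseteq> U - set C"
  proof
    fix w assume "w \<in> S"
    then obtain P where "P \<noteq> []" "last P = w" "set P \<subseteq> U - set C" by (auto simp: S_def)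
    then show "w \<in> U - set C" using last_in_set[of P] by blast
  qed
  then have "S \<subseteq> U" "S \<noteq> U" using assms(3) xz by auto
  then obtain w v where wv: "w \<in> S" "v \<in> U - S" "E w v"
    using assms(1) \<open>z \<in> S\<close> unfolding out_closed_free_def by blast
  obtain P where P: "dpath E P" "P \<noteq> []" "hd P = z" "last P = w" "set P \<subseteq> U - set C"
    using wv(1) by (auto simp: S_def)
  have "v \<in> set C"
  proof (rule ccontr)
    assume v: "v \<notin> set C"
    have "v \<notin> set P"
    proof
      assume "v \<in> set P"
      then obtain xs ys where "P = xs @ v # ys" by (meson split_list)
      then have "dpath E (xs @ [v])" "hd (xs @ [v]) = z" "set (xs @ [v]) \<subseteq> U - set C"
        using P by (auto simp: dpath_append dpath_Cons hd_append)
      then have "v \<in> S" unfolding S_def by (intro CollectI exI[of _ "xs @ [v]"]) simp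
      then show False using wv by auto
    qed
    then have "dpath E (P @ [v])" "set (P @ [v]) \<subseteq> U - set C"
      using P wv v by (auto simp: dpath_append)
    then have "v \<in> S" unfolding S_def using P by (intro CollectI exI[of _ "P @ [v]"]) simp
    then show False using wv by auto
  qed
  then obtain xs ys where C: "C = xs @ v # ys" by (meson split_list)
  \<comment> \<open>The cycle is rotated to start at the return vertex \<open>v\<close>, and then
    cut behind the exit vertex \<open>x\<close>.\<close>
  have C': "dcycle E (v # ys @ xs)" using dcycle_rotate[of E xs "v # ys"] assms(2) C by simp
  have "x \<in> set (v # ys @ xs)" using xz C by auto
  then obtain us vs where uv: "v # ys @ xs = us @ x # vs" by (meson split_list)
  have "hd (us @ [x]) = v" using uv by (cases us) auto
  moreover have "set (us @ [x] @ vs) = set C"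
    using arg_cong[OF uv, of set] C by auto
  moreover have "length (us @ [x] @ vs) = length C"
    using arg_cong[OF uv, of length] C by auto
  moreover have "dcycle E ((us @ [x]) @ vs)" using C' uv by simp
  ultimately have "bypass U (length C) (us @ [x]) vs P"
    unfolding bypass_def using P xz wv assms(3) by auto
  then show ?thesis by blast
qed

end

section \<open>Bypasses with a shortest gap\<close>

context rel_digraph
begin

text \<open>The new detour branches off at the gap vertex \<open>y\<close>, so \<open>T1\<close> and
  \<open>y\<close> join \<open>L\<close> and only \<open>T2\<close> remains as gap. In the mirror
  case below the detour returns early, at \<open>y\<close>.\<close>

lemma bypass_shorten_left:
  assumes "bypass U m L (T1 @ y # T2) P" "dpath E R" "R \<noteq> []" "set R \<subseteq> U - set (L @ T1 @ y # T2)"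
    "E y (hd R)" "E (last R) (hd L)"
  shows "bypass U m (L @ T1 @ [y]) T2 R"
  using assms unfolding bypass_def by auto

lemma bypass_shorten_right:
  assumes "bypass U m L (T1 @ y # T2) P" "dpath E R" "R \<noteq> []" "set R \<subseteq> U - set (L @ T1 @ y # T2)"
    "E (last L) (hd R)" "E (last R) y"
  shows "bypass U m (y # T2 @ L) T1 R"
  using assms dcycle_rotate[of E "L @ T1" "y # T2"] unfolding bypass_def by auto

text \<open>The minimum ranges over all cycles of length \<open>m\<close> in \<open>U\<close>, not
  over one fixed cycle.\<close>

definition min_bypass :: "'v set \<Rightarrow> nat \<Rightarrow> 'v list \<Rightarrow> 'v list \<Rightarrow> 'v list \<Rightarrow> bool" where
  "min_bypass U m L T P \<longleftrightarrow> bypass U m L T P \<and> (\<forall>L' T' P'. bypass U m L' T' P' \<longrightarrow> length T \<le> length T')"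

lemma min_bypassD: "min_bypass U m L T P \<Longrightarrow> bypass U m L T P"
  by (simp add: min_bypass_def)

lemma min_bypass_exists:
  assumes "bypass U m L T P"
  obtains L' T' P' where "min_bypass U m L' T' P'"
proof -
  define A where "A = {g. \<exists>L T P. bypass U m L T P \<and> length T = g}"
  have "length T \<in> A" using assms A_def by blast
  then have "(LEAST g. g \<in> A) \<in> A" by (rule LeastI)
  then obtain L' T' P' where "bypass U m L' T' P'" "length T' = (LEAST g. g \<in> A)"
    by (auto simp: A_def)
  moreover have "\<And>L'' T'' P''. bypass U m L'' T'' P'' \<Longrightarrow> (LEAST g. g \<in> A) \<le> length T''"
    by (rule Least_le) (auto simp: A_def)
  ultimately show ?thesis using that unfolding min_bypass_def by metis
qed

lemma min_bypass_no_left: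
  assumes "min_bypass U m L T P" "y \<in> set T" "dpath E R" "R \<noteq> []" "set R \<subseteq> U - set (L @ T)"
    "E y (hd R)"
  shows "\<not> E (last R) (hd L)"
proof
  assume "E (last R) (hd L)"
  obtain T1 T2 where T: "T = T1 @ y # T2" using assms(2) by (meson split_list)
  have "bypass U m (L @ T1 @ [y]) T2 R"
    using assms min_bypassD[OF assms(1)] T \<open>E (last R) (hd L)\<close>
    by (intro bypass_shorten_left[of U m L T1 y T2 P]) auto
  then have "length T \<le> length T2" using assms(1) unfolding min_bypass_def by blast
  then show False using T by simp
qed

lemma min_bypass_no_right:
  assumes "min_bypass U m L T P" "y \<in> set T" "dpath E R" "R \<noteq> []" "set R \<subseteq> U - set (L @ T)"
    "E (last R) y"
  shows "\<not> E (last L) (hd R)"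
proof
  assume "E (last L) (hd R)"
  obtain T1 T2 where T: "T = T1 @ y # T2" using assms(2) by (meson split_list)
  have "bypass U m (y # T2 @ L) T1 R"
    using assms min_bypassD[OF assms(1)] T \<open>E (last L) (hd R)\<close>
    by (intro bypass_shorten_right[of U m L T1 y T2 P]) auto
  then have "length T \<le> length T1" using assms(1) unfolding min_bypass_def by blast
  then show False using T by simp
qed

text \<open>An arc between detour and gap, or a connection through one vertex off the cycle, would
  give a bypass with a shorter gap. The third claim feeds \<open>deg_in_pair_le\<close>.\<close>

lemma min_bypass_nonadj:
  assumes mb: "min_bypass U m L T P" and x: "x \<in> set P" and y: "y \<in> set T"
  shows "\<not> E x y" "\<not> E y x"
    and "z \<in> U - set (L @ T) \<Longrightarrow> \<not> (E x z \<and> E z y) \<and> \<not> (E y z \<and> E z x)"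
proof -
  have P: "dpath E P" "set P \<subseteq> U - set (L @ T)" "E (last L) (hd P)" "E (last P) (hd L)" "P \<noteq> []"
    using min_bypassD[OF mb] unfolding bypass_def by auto
  have R: "\<not> E x y" if xP: "x \<in> set P" for x
  proof
    assume xy: "E x y"
    obtain P1 P2 where P12: "P = P1 @ x # P2" using xP by (meson split_list)
    have "hd (P1 @ [x]) = hd P" using P12 by (cases P1) auto
    then show False
      using min_bypass_no_right[OF mb y, of "P1 @ [x]"] P P12 xy by (auto simp: dpath_append dpath_Cons)
  qed
  have L: "\<not> E y x" if xP: "x \<in> set P" for x
  proof
    assume xy: "E y x"
    obtain P1 P2 where P12: "P = P1 @ x # P2" using xP by (meson split_list)
    then show False
      using min_bypass_no_left[OF mb y, of "x # P2"] P P12 xy by (auto simp: dpath_append)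
  qed
  show "\<not> E x y" "\<not> E y x" using R L x by auto
  assume z: "z \<in> U - set (L @ T)"
  show "\<not> (E x z \<and> E z y) \<and> \<not> (E y z \<and> E z x)"
  proof (cases "z \<in> set P")
    case True
    then show ?thesis using R L by auto
  next
    case False
    obtain P1 P2 where P12: "P = P1 @ x # P2" using x by (meson split_list)
    have hd: "hd (P1 @ [x, z]) = hd P" using P12 by (cases P1) auto
    have "\<not> (E x z \<and> E z y)"
    proof
      assume "E x z \<and> E z y"
      moreover from this have "dpath E (P1 @ [x, z])" using P P12 False by (auto simp: dpath_append dpath_Cons)
      ultimately show False
        using min_bypass_no_right[OF mb y, of "P1 @ [x, z]"] hd P P12 z by auto
    qed
    moreover have "\<not> (E y z \<and> E z x)"
    proof
      assume "E y z \<and> E z x"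
      moreover from this have "dpath E (z # x # P2)" using P P12 False by (auto simp: dpath_append dpath_Cons)
      ultimately show False
        using min_bypass_no_left[OF mb y, of "z # x # P2"] P P12 z by auto
    qed
    ultimately show ?thesis by blast
  qed
qed

lemma deg_in_leftover:
  assumes "dpath E Q" "finite Y" "y \<in> Y" "Y \<inter> set Q = {}" "deg_in E (set Q) y \<le> length Q + 1"
  shows "deg_in E (set Q \<union> Y) y + 1 \<le> length Q + 2 * card Y"
proof -
  have "deg_in E (set Q \<union> Y) y = deg_in E (set Q) y + deg_in E (insert y (Y - {y})) y"
    using assms insert_Diff[of y Y] by (subst deg_in_union) auto
  also have "deg_in E (insert y (Y - {y})) y = deg_in E (Y - {y}) y"
    using assms E_irrefl by (subst deg_in_insert) auto
  also have "\<dots> \<le> 2 * card (Y - {y})" using assms by (intro deg_in_le) auto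
  finally have "deg_in E (set Q \<union> Y) y \<le> length Q + 1 + 2 * card (Y - {y})" using assms by linarith
  moreover have "card (Y - {y}) + 1 = card Y" using assms card_Suc_Diff1[of Y y] by simp
  ultimately show ?thesis by linarith
qed

text \<open>\<open>Y\<close> is what greedy insertion of the gap into \<open>L\<close> leaves over.
  The vertex \<open>x\<close> cannot be inserted into \<open>L\<close> and has no arcs with the gap,
  \<open>y\<close> has small degree into the enlarged path, and every other vertex off the cycle
  adds at most 2 to both degrees together. As \<open>card Y\<close> is at most
  \<open>length T\<close>, the degree sum is at most \<open>2 * card U - 2\<close>.\<close>

lemma min_bypass_degrees:
  assumes mb: "min_bypass U m L T P" and U: "U \<subseteq> V"
    and longest: "\<And>C. dcycle E C \<Longrightarrow> length C \<le> m"
  shows "\<exists>Y. Y \<subseteq> set T \<and> Y \<noteq> {} \<and>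
    (\<forall>x\<in>set P. \<forall>y\<in>Y. deg_in E U x + deg_in E U y + 2 + length T \<le> 2 * card U + card Y)"
proof -
  have B: "dcycle E (L @ T)" "L \<noteq> []" "P \<noteq> []" "dpath E P" "set (L @ T) \<subseteq> U" "set P \<subseteq> U"
     "set P \<inter> set (L @ T) = {}" "length (L @ T) = m" "E (last L) (hd P)" "E (last P) (hd L)"
    using min_bypassD[OF mb] unfolding bypass_def by auto
  have finU: "finite U" using U finite_V finite_subset by blast
  have dLT: "distinct (L @ T)" and dL: "dpath E L" using B(1) by (auto simp: dcycle_def dpath_def successively_append_iff)
  have "set T \<inter> set L = {}" using dLT by auto
  then obtain Q T' where Q: "T' \<subseteq> set T" "dpath E Q" "Q \<noteq> []" "set Q = set L \<union> T'" "hd Q = hd L"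
      "last Q = last L" "\<forall>y\<in>set T - T'. deg_in E (set Q) y \<le> length Q + 1"
    using maximal_insertion[OF dL B(2), of "set T"] by auto
  define Y where "Y = set T - T'"
  have finY: "finite Y" by (simp add: Y_def)
  have cover: "set Q \<union> Y = set (L @ T)" "set Q \<inter> Y = {}"
    using Q \<open>set T \<inter> set L = {}\<close> by (auto simp: Y_def)
  have lenQ: "length Q + card Y = m"
  proof -
    have "card (set Q \<union> Y) = card (set Q) + card Y" using cover finY by (intro card_Un_disjoint) auto
    then show ?thesis using cover(1) dLT B(8) Q(2) by (metis distinct_card dpath_def)
  qed
  \<comment> \<open>If the whole gap were inserted, \<open>Q\<close> followed by the detour would be
    a cycle longer than \<open>m\<close>.\<close>
  have "Y \<noteq> {}"
  proof
    assume "Y = {}"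
    then have "set Q = set (L @ T)" "length Q = m" using cover lenQ by auto
    then have "dcycle E (Q @ P)" using Q B by (auto simp: dcycle_def dpath_append)
    then show False using longest[of "Q @ P"] B(3) \<open>length Q = m\<close> by (cases P) auto
  qed
  have "deg_in E U x + deg_in E U y + 2 + length T \<le> 2 * card U + card Y" if x: "x \<in> set P" and y: "y \<in> Y" for x y
  proof -
    have yT: "y \<in> set T" using y by (simp add: Y_def)
    have na: "\<not> E x y'" "\<not> E y' x" if "y' \<in> set T" for y' using min_bypass_nonadj[OF mb x that] by auto
    define W where "W = U - set (L @ T) - {x}"
    have U_eq: "U = (set L \<union> set T) \<union> insert x W" using B x by (auto simp: W_def)
    have disj: "(set L \<union> set T) \<inter> insert x W = {}" "x \<notin> W" using B x by (auto simp: W_def)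
    have finW: "finite W" using finU by (simp add: W_def)
    have split: "deg_in E U v = deg_in E (set L \<union> set T) v + deg_in E {x} v + deg_in E W v" for v
      using U_eq disj finW deg_in_union[of "set L \<union> set T" "insert x W" E v] deg_in_union[of "{x}" W E v] by auto
    have cardU: "card U = m + 1 + card W"
    proof -
      have "card U = card (set (L @ T)) + card (insert x W)"
        using U_eq disj finW by (subst U_eq, subst card_Un_disjoint) auto
      then show ?thesis using dLT B(8) disj finW by (simp add: distinct_card del: set_append)
    qed
    have W2: "deg_in E W x + deg_in E W y \<le> 2 * card W"
      using finW min_bypass_nonadj(3)[OF mb x yT] by (intro deg_in_pair_le) (auto simp: W_def)
    have x0: "deg_in E {x} x = 0" "deg_in E {x} y = 0" using E_irrefl na[OF yT] by (auto simp: deg_in_single)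
    have "deg_in E (set L) x \<le> length L + 1"
    proof (rule ccontr)
      assume "\<not> ?thesis"
      then obtain ys zs where ins: "L = ys @ zs" "ys \<noteq> []" "zs \<noteq> []" "E (last ys) x" "E x (hd zs)"
        using insertion_point[of L E x] dLT by auto
      have "dpath E (ys @ x # zs @ T)" using ins B x
        by (intro dpath_insert) (auto simp: dcycle_def)
      then have "dcycle E (ys @ x # zs @ T)" using B ins by (auto simp: dcycle_def)
      then show False using longest ins B(8) by fastforce
    qed
    moreover have "deg_in E (set L \<union> set T) x = deg_in E (set L) x + deg_in E (set T) x"
      using dLT by (intro deg_in_union) auto
    moreover have "deg_in E (set T) x = 0" using na by (intro deg_in_eq_0) auto
    ultimately have X: "deg_in E (set L \<union> set T) x \<le> length L + 1" by simp
    have "deg_in E (set Q \<union> Y) y + 1 \<le> length Q + 2 * card Y"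
      using Q y cover finY by (intro deg_in_leftover) (auto simp: Y_def)
    then have "deg_in E (set L \<union> set T) y + 1 \<le> m + card Y" using cover lenQ by simp
    then show ?thesis using split[of x] split[of y] x0 W2 X cardU B(8) by simp
  qed
  then show ?thesis using \<open>Y \<noteq> {}\<close> Y_def by blast
qed

end

section \<open>A cycle missing a single vertex\<close>

context rel_digraph
begin

lemma dcycle_subset: "dcycle E C \<Longrightarrow> set C \<subseteq> V"
proof
  fix x assume C: "dcycle E C" and "x \<in> set C"
  then obtain us vs where "C = us @ x # vs" by (meson split_list)
  then have "dcycle E ((x # vs) @ us)" using C dcycle_rotate by metis
  then show "x \<in> V" using E_in by (auto simp: dcycle_def)
qed

text \<open>The end of a longest path has an out-neighbour, which lies on the path and so closes a
  cycle; cycle lengths are bounded by \<open>card V\<close>.\<close>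

lemma longest_dcycle_exists:
  assumes "out_closed_free V" "card V \<ge> 2"
  obtains C where "dcycle E C" "\<And>C'. dcycle E C' \<Longrightarrow> length C' \<le> length C"
proof -
  have out: "\<exists>y. E x y" if x: "x \<in> V" for x
  proof -
    have "{x} \<noteq> V" using assms(2) by auto
    then show ?thesis using assms(1) x unfolding out_closed_free_def
      by (metis empty_iff empty_subsetI insert_subset singletonD subset_insertI)
  qed
  have bound: "length xs < Suc (card V)" if "dpath E xs" "set xs \<subseteq> V" for xs
    using that finite_V card_mono[of V "set xs"] by (simp add: dpath_def distinct_card)
  obtain v where "v \<in> V" using assms(2) by fastforce
  then have "dpath E [v] \<and> [v] \<noteq> [] \<and> set [v] \<subseteq> V" by simp
  then obtain xs where xs: "dpath E xs" "xs \<noteq> []" "set xs \<subseteq> V"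
    and longest: "\<And>ys. dpath E ys \<and> ys \<noteq> [] \<and> set ys \<subseteq> V \<Longrightarrow> length ys \<le> length xs"
    using ex_has_greatest_nat[of "\<lambda>xs. dpath E xs \<and> xs \<noteq> [] \<and> set xs \<subseteq> V" "[v]" length "Suc (card V)"] bound
    by blast
  have "last xs \<in> V" using xs by auto
  then obtain y where y: "E (last xs) y" using out by blast
  have "y \<in> set xs"
  proof (rule ccontr)
    assume "y \<notin> set xs"
    then have "dpath E (xs @ [y])" using xs y by (auto simp: dpath_append)
    then show False using longest[of "xs @ [y]"] xs y E_in by auto
  qed
  then obtain us vs where "xs = us @ y # vs" by (meson split_list)
  then have "dcycle E (y # vs)" using xs y by (auto simp: dcycle_def dpath_append)
  then obtain C where "dcycle E C" "\<And>C'. dcycle E C' \<Longrightarrow> length C' \<le> length C"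
    using ex_has_greatest_nat[of "dcycle E" "y # vs" length "Suc (card V)"] bound dcycle_subset
    by (metis dcycle_def)
  then show ?thesis using that by blast
qed

text \<open>Otherwise there is a bypass inside \<open>V - {a}\<close>. Its degree bound is so low
  that \<open>deg\<close> forces at least three of the four possible arcs between \<open>a\<close>
  and \<open>x\<close>, \<open>y\<close>, and then the cycle can be lengthened through
  \<open>a\<close>.\<close>

lemma longest_dcycle_misses_one:
  assumes strong: "out_closed_free (V - {a})" and a: "a \<in> V" "a \<notin> set C"
    and C: "dcycle E C" and longest: "\<And>C'. dcycle E C' \<Longrightarrow> length C' \<le> length C"
    and deg: "\<And>x y. nonadj x y \<Longrightarrow> a \<notin> {x, y} \<Longrightarrow> dg x + dg y + 1 \<ge> 2 * card V"
  shows "set C = V - {a}"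
proof (rule ccontr)
  assume "set C \<noteq> V - {a}"
  define U where "U = V - {a}"
  have "set C \<subset> U" using \<open>set C \<noteq> V - {a}\<close> dcycle_subset[OF C] a by (auto simp: U_def)
  then obtain L T P where "bypass U (length C) L T P"
    using bypass_exists strong C unfolding U_def by blast
  then obtain L T P where mb: "min_bypass U (length C) L T P" by (rule min_bypass_exists)
  have B: "dcycle E (L @ T)" "L \<noteq> []" "P \<noteq> []" "dpath E P" "set (L @ T) \<subseteq> U" "set P \<subseteq> U"
     "set P \<inter> set (L @ T) = {}" "length (L @ T) = length C" "E (last L) (hd P)" "E (last P) (hd L)"
    using min_bypassD[OF mb] unfolding bypass_def by auto
  have dLT: "distinct T" using B(1) by (auto simp: dcycle_def dpath_def)
  obtain Y where Y: "Y \<subseteq> set T" "Y \<noteq> {}"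
    and degs: "\<And>x y. x \<in> set P \<Longrightarrow> y \<in> Y \<Longrightarrow> deg_in E U x + deg_in E U y + 2 + length T \<le> 2 * card U + card Y"
    using min_bypass_degrees[OF mb _ longest] U_def by blast
  have "card Y \<le> length T" using Y card_mono[of "set T" Y] card_length[of T] by auto
  obtain P2 x where P: "P = x # P2" using B(3) by (cases P) auto
  have aP: "a \<notin> set P" "a \<notin> set L" "a \<notin> set T" using B by (auto simp: U_def)
  have cU: "card V = Suc (card U)" using a finite_V unfolding U_def
    by (metis card_Suc_Diff1)
  have contr: "deg_in E {a} x + deg_in E {a} y + card Y \<ge> 3 + length T" if "y \<in> Y" for y
  proof -
    have "nonadj x y" using min_bypass_nonadj[OF mb, of x y] Y that P B
      unfolding nonadj_def by (auto simp: U_def)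
    then have "dg x + dg y + 1 \<ge> 2 * card V" using deg[of x y] aP that Y P by auto
    moreover have "dg v = deg_in E {a} v + deg_in E U v" for v
      using deg_in_union[of "{a}" U E v] a finite_V by (simp add: U_def insert_absorb)
    ultimately show ?thesis using degs[of x y] that P cU by simp
  qed
  \<comment> \<open>Otherwise \<open>x\<close> and \<open>a\<close> would fit between
    \<open>L\<close> and \<open>T\<close>. For the companion fact \<open>last\<close>,
    \<open>a\<close> and \<open>P\<close> would fit between \<open>T\<close> and
    \<open>L\<close>.\<close>
  have first: "\<not> (E x a \<and> E a (hd T))" if "T \<noteq> []"
  proof
    assume *: "E x a \<and> E a (hd T)"
    have "dcycle E (T @ L)" using B(1) dcycle_rotate by blast
    then have "dcycle E ((T @ L) @ [x, a])"
      using * B that aP P unfolding dcycle_def by (auto simp: dpath_append dpath_Cons)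
    then show False using longest[of "(T @ L) @ [x, a]"] B(8) by simp
  qed
  have last: "\<not> (E (last T) a \<and> E a x)" if "T \<noteq> []"
  proof
    assume *: "E (last T) a \<and> E a x"
    then have "dcycle E ((L @ T) @ a # P)"
      using B that aP P unfolding dcycle_def by (auto simp: dpath_append dpath_Cons)
    then show False using longest[of "(L @ T) @ a # P"] B(8) by simp
  qed
  have "T \<noteq> []" using Y by auto
  show False
  proof (cases "card Y = length T")
    case True
    then have "Y = set T" using Y dLT by (intro card_subset_eq) (auto simp: distinct_card)
    then have c3: "deg_in E {a} x + deg_in E {a} y \<ge> 3" if "y \<in> set T" for y
      using contr[of y] that True by auto
    \<comment> \<open>At most one of the four arcs is missing, and by \<open>first\<close> it is
      \<open>E x a\<close> or \<open>E a (hd T)\<close>; so the other two are present.\<close>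
    have "E (hd T) a" "E a x" using c3[of "hd T"] first \<open>T \<noteq> []\<close>
      by (auto simp: deg_in_single split: if_splits)
    then have "\<not> E (last T) a" using last \<open>T \<noteq> []\<close> by auto
    have adj: "E a y \<or> E y a" if "y \<in> set T" for y
      using c3[OF that] by (auto simp: deg_in_single split: if_splits)
    \<comment> \<open>Arcs to \<open>a\<close> exist at the start of \<open>T\<close> but not at its
      end. At the first vertex without one, adjacency gives an arc from \<open>a\<close>, so
      \<open>a\<close> can be inserted there.\<close>
    obtain ys zs where yz: "T = ys @ zs" "ys \<noteq> []" "zs \<noteq> []" "E (last ys) a" "\<not> E (hd zs) a"
    proof -
      define ys where "ys = takeWhile (\<lambda>y. E y a) T"
      define zs where "zs = dropWhile (\<lambda>y. E y a) T"
      have "T = ys @ zs" by (simp add: ys_def zs_def)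
      moreover have "ys \<noteq> []" using \<open>E (hd T) a\<close> \<open>T \<noteq> []\<close> by (cases T) (auto simp: ys_def)
      moreover have "zs \<noteq> []" using \<open>\<not> E (last T) a\<close> \<open>T \<noteq> []\<close> by (auto simp: zs_def)
      moreover have "E (last ys) a" using \<open>ys \<noteq> []\<close>
        set_takeWhileD[of "last ys" "\<lambda>y. E y a" T] last_in_set[of ys] by (simp add: ys_def)
      moreover have "\<not> E (hd zs) a" using \<open>zs \<noteq> []\<close> hd_dropWhile[of "\<lambda>y. E y a" T] by (simp add: zs_def)
      ultimately show ?thesis using that by blast
    qed
    then have "E a (hd zs)" using adj[of "hd zs"] by auto
    then have "dpath E ((L @ ys) @ a # zs)" using B(1) yz aP
      by (intro dpath_insert) (auto simp: dcycle_def)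
    then have "dcycle E ((L @ ys) @ a # zs)" using B(1) yz B(2) by (auto simp: dcycle_def)
    then show False using longest[of "(L @ ys) @ a # zs"] B(8) yz by simp
  next
    case False
    \<comment> \<open>Now all four arcs are present, so \<open>first\<close> and \<open>last\<close>
      keep both ends of \<open>T\<close> out of \<open>Y\<close>; but at most one gap vertex is
      outside \<open>Y\<close>.\<close>
    have 4: "E x a \<and> E a x \<and> E y a \<and> E a y" if "y \<in> Y" for y
      using contr[OF that] False \<open>card Y \<le> length T\<close> by (auto simp: deg_in_single split: if_splits)
    then have "hd T \<notin> Y" "last T \<notin> Y" using first last \<open>T \<noteq> []\<close> by auto
    have "card (set T - Y) \<le> 1"
    proof -
      obtain y where "y \<in> Y" using Y by blast
      moreover have "deg_in E {a} x + deg_in E {a} y \<le> 4" by (simp add: deg_in_single)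
      ultimately have "length T \<le> card Y + 1" using contr by fastforce
      moreover have "card (set T - Y) = length T - card Y"
        using Y dLT by (subst card_Diff_subset) (auto simp: distinct_card finite_subset)
      ultimately show ?thesis by simp
    qed
    moreover have "hd T \<in> set T - Y" "last T \<in> set T - Y" using \<open>hd T \<notin> Y\<close> \<open>last T \<notin> Y\<close> \<open>T \<noteq> []\<close> by auto
    ultimately have "hd T = last T" using card_le_Suc0_iff_eq[of "set T - Y"] by auto
    then have "T = [hd T]" using dLT \<open>T \<noteq> []\<close> by (cases T) (auto split: if_splits)
    then show False using Y \<open>hd T \<notin> Y\<close>
      by (metis list.set(1) list.simps(15) subset_singletonD insertI1)
  qed
qed

end

text \<open>The situation to be refuted: the hypotheses of the theorem together with
  non-Hamiltonicity. \<open>M\<close> adds 3 on the right to avoid truncated subtraction.\<close>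

locale M_digraph = rel_digraph +
  assumes card_V: "card V \<ge> 3"
    and strong: "out_closed_free V"
    and strong_del: "v \<in> V \<Longrightarrow> out_closed_free (V - {v})"
    and M: "nonadj x y \<Longrightarrow> nonadj w z \<Longrightarrow> {x, y} \<noteq> {w, z} \<Longrightarrow> 4 * card V \<le> dg x + dg y + dg w + dg z + 3"
    and not_ham: "\<not> (dcycle E C \<and> set C = V)"
begin

text \<open>A bypass of a longest cycle gives a pair with degree sum at most
  \<open>2 * card V - 2\<close>. By \<open>M\<close> every other pair then has at least
  \<open>2 * card V - 1\<close>, as \<open>longest_dcycle_misses_one\<close> demands.\<close>

lemma exceptional_pair:
  obtains a b R where "nonadj a b" "dg a + dg b + 2 \<le> 2 * card V" "dcycle E (b # R)" "set (b # R) = V - {a}"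
proof -
  obtain C where C: "dcycle E C" "\<And>C'. dcycle E C' \<Longrightarrow> length C' \<le> length C"
    using longest_dcycle_exists strong card_V by (metis One_nat_def Suc_1 Suc_leD eval_nat_numeral(3))
  have "set C \<subset> V" using dcycle_subset[OF C(1)] not_ham C(1) by blast
  then obtain L T P where "bypass V (length C) L T P"
    using bypass_exists strong C by blast
  then obtain L T P where mb: "min_bypass V (length C) L T P" by (rule min_bypass_exists)
  have B: "dcycle E (L @ T)" "P \<noteq> []" "set P \<subseteq> V" "set P \<inter> set (L @ T) = {}" "length (L @ T) = length C"
    using min_bypassD[OF mb] unfolding bypass_def by auto
  obtain Y where Y: "Y \<subseteq> set T" "Y \<noteq> {}"
    and degs: "\<And>x y. x \<in> set P \<Longrightarrow> y \<in> Y \<Longrightarrow> dg x + dg y + 2 + length T \<le> 2 * card V + card Y"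
    using min_bypass_degrees[OF mb _ C(2)] by blast
  have "card Y \<le> length T" using Y card_mono[of "set T" Y] card_length[of T] by auto
  obtain b where b: "b \<in> Y" using Y by blast
  define a where "a = hd P"
  have a: "a \<in> set P" using B by (simp add: a_def)
  have LTV: "set (L @ T) \<subseteq> V" using dcycle_subset[OF B(1)] .
  have bT: "b \<in> set T" using b Y by blast
  have nab: "nonadj a b"
    unfolding nonadj_def using min_bypass_nonadj[OF mb a bT] a B LTV bT by auto
  moreover have d: "dg a + dg b + 2 \<le> 2 * card V" using degs[OF a b] \<open>card Y \<le> length T\<close> by linarith
  moreover have "set (L @ T) = V - {a}"
  proof (rule longest_dcycle_misses_one)
    show "out_closed_free (V - {a})" "a \<in> V" "a \<notin> set (L @ T)" "dcycle E (L @ T)"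
      using strong_del a B by auto
    show "length C' \<le> length (L @ T)" if "dcycle E C'" for C' using C(2)[OF that] B(5) by simp
    fix x y assume xy: "nonadj x y" "a \<notin> {x, y}"
    then have "{x, y} \<noteq> {a, b}" by auto
    then show "dg x + dg y + 1 \<ge> 2 * card V" using M[OF xy(1) nab] d by linarith
  qed
  moreover obtain T1 T2 where T: "T = T1 @ b # T2" using bT by (meson split_list)
  moreover have "dcycle E (b # (T2 @ L @ T1))" using dcycle_rotate[of E "L @ T1" "b # T2"] B(1) T by simp
  moreover have "set (b # (T2 @ L @ T1)) = set (L @ T)" using T by auto
  ultimately show ?thesis using that[of a b "T2 @ L @ T1"] by simp
qed

end

section \<open>The order of the neighbours of a bad pair\<close>

context rel_digraph
begin

lemma out_neighbour_avoiding:
  assumes "card V \<ge> 3" "out_closed_free (V - {v})" "x \<in> V" "v \<noteq> x"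
  shows "\<exists>y. y \<noteq> v \<and> E x y"
proof -
  have "{x} \<noteq> V - {v}"
  proof
    assume "{x} = V - {v}"
    then have "V \<subseteq> {x, v}" by auto
    then show False using assms(1) card_mono[of "{x, v}" V] card_insert_le_m1[of 2 "{v}" x] by auto
  qed
  then show ?thesis using assms(2-4) unfolding out_closed_free_def by blast
qed

text \<open>As \<open>out_closed_free\<close> yields arcs leaving a set, it is applied to the
  complement of \<open>{v, x}\<close>.\<close>

lemma in_neighbour_avoiding:
  assumes "card V \<ge> 3" "out_closed_free (V - {v})" "x \<in> V" "v \<noteq> x"
  shows "\<exists>y. y \<noteq> v \<and> E y x"
proof -
  have "V - {v, x} \<noteq> {}"
  proof
    assume "V - {v, x} = {}"
    then have "V \<subseteq> {x, v}" by auto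
    then show False using assms(1) card_mono[of "{x, v}" V] card_insert_le_m1[of 2 "{v}" x] by auto
  qed
  moreover have "V - {v, x} \<noteq> V - {v}" using assms by auto
  ultimately obtain y z where "y \<in> V - {v, x}" "z \<in> V - {v} - (V - {v, x})" "E y z"
    using assms(2) unfolding out_closed_free_def by (metis Diff_mono empty_subsetI insert_mono subset_refl)
  then show ?thesis by auto
qed

end

context M_digraph
begin

text \<open>Some gap vertex resists insertion into \<open>L\<close>, since otherwise
  \<open>a\<close> would close a Hamiltonian cycle. A resisting vertex other than \<open>b\<close>
  would form a second bad pair with \<open>a\<close>, so \<open>b\<close> is the only one.\<close>

lemma reinsert_gap:
  assumes ab: "nonadj a b" and bad: "dg a + dg b + 2 \<le> 2 * card V"
    and C: "dcycle E (L @ T)" "set (L @ T) = V - {a}" "L \<noteq> []" "E (last L) a" "E a (hd L)"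
    and gap: "\<And>y. y \<in> set T \<Longrightarrow> \<not> E a y \<and> \<not> E y a"
  shows "b \<in> set T" and "\<exists>Q. dpath E Q \<and> Q \<noteq> [] \<and> set Q = V - {a, b} \<and> hd Q = hd L \<and> last Q = last L"
proof -
  have aV: "a \<in> V" using ab by (simp add: nonadj_def)
  have dLT: "distinct (L @ T)" and dL: "dpath E L"
    using C(1) by (auto simp: dcycle_def dpath_def successively_append_iff)
  have "set T \<inter> set L = {}" using dLT by auto
  then obtain Q T' where Q: "T' \<subseteq> set T" "dpath E Q" "Q \<noteq> []" "set Q = set L \<union> T'" "hd Q = hd L"
      "last Q = last L" "\<forall>y\<in>set T - T'. deg_in E (set Q) y \<le> length Q + 1"
    using maximal_insertion[OF dL C(3), of "set T"] by auto
  define Y where "Y = set T - T'"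
  have finY: "finite Y" by (simp add: Y_def)
  have cover: "set Q \<union> Y = set (L @ T)" "set Q \<inter> Y = {}"
    using Q \<open>set T \<inter> set L = {}\<close> by (auto simp: Y_def)
  have len: "length L + length T + 1 = card V"
  proof -
    have "card (set (L @ T)) + 1 = card V" unfolding C(2) using aV finite_V
      by (metis Suc_eq_plus1 card_Suc_Diff1)
    then show ?thesis using dLT by (simp add: distinct_card del: set_append)
  qed
  have lenQ: "length Q + card Y + 1 = card V"
  proof -
    have "card (set Q \<union> Y) = card (set Q) + card Y" using cover finY by (intro card_Un_disjoint) auto
    moreover have "card (set (L @ T)) = length (L @ T)" using dLT by (rule distinct_card)
    moreover have "card (set Q) = length Q" using Q(2) by (simp add: dpath_def distinct_card)
    ultimately show ?thesis using cover(1) len by simp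
  qed
  have cY: "card Y \<le> length T"
    using card_mono[of "set T" Y] card_length[of T] by (auto simp: Y_def)
  have ne: "Y \<noteq> {}"
  proof
    assume "Y = {}"
    then have "set Q = V - {a}" using cover C(2) by auto
    moreover from this have "dcycle E (Q @ [a])" using Q C by (auto simp: dcycle_def dpath_append)
    ultimately show False using not_ham[of "Q @ [a]"] aV by auto
  qed
  have split: "dg v = deg_in E {a} v + deg_in E (set (L @ T)) v" for v
    using deg_in_union[of "{a}" "V - {a}" E v] aV finite_V C(2) by (simp add: insert_absorb)
  have "deg_in E (set L) a \<le> length L + 1"
  proof (rule ccontr)
    assume "\<not> ?thesis"
    then obtain ys zs where ins: "L = ys @ zs" "ys \<noteq> []" "zs \<noteq> []" "E (last ys) a" "E a (hd zs)"
      using insertion_point[of L E a] dLT by auto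
    have "a \<notin> set (L @ T)" using C(2) by blast
    then have "dpath E (ys @ a # zs @ T)" using ins C by (intro dpath_insert) (auto simp: dcycle_def)
    then have "dcycle E (ys @ a # zs @ T)" using C ins by (auto simp: dcycle_def)
    moreover have "set (ys @ a # zs @ T) = V" using C(2) ins aV by auto
    ultimately show False using not_ham by blast
  qed
  moreover have "deg_in E (set (L @ T)) a = deg_in E (set L) a + deg_in E (set T) a"
    using \<open>set T \<inter> set L = {}\<close> unfolding set_append by (intro deg_in_union) auto
  moreover have "deg_in E (set T) a = 0" using gap by (intro deg_in_eq_0) auto
  ultimately have da: "dg a \<le> length L + 1" using split[of a] E_irrefl by (simp add: deg_in_single)
  have "y = b" if y: "y \<in> Y" for y
  proof (rule ccontr)
    assume "y \<noteq> b"
    have yT: "y \<in> set T" using y by (simp add: Y_def)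
    have "y \<in> V" "y \<noteq> a" using yT C(2) by auto
    then have nay: "nonadj a y" using gap[OF yT] aV by (simp add: nonadj_def)
    have "deg_in E (set Q \<union> Y) y + 1 \<le> length Q + 2 * card Y"
      using Q y cover finY by (intro deg_in_leftover) (auto simp: Y_def)
    moreover have "dg y = deg_in E (set Q \<union> Y) y"
      using split[of y] gap[OF yT] cover by (simp add: deg_in_single)
    ultimately have "dg a + dg y + 2 \<le> 2 * card V" using da lenQ len cY by linarith
    moreover have "{a, b} \<noteq> {a, y}" using \<open>y \<noteq> b\<close> by (auto simp: doubleton_eq_iff)
    ultimately show False using M[OF ab nay] bad by linarith
  qed
  then have "Y = {b}" using ne by blast
  then show "b \<in> set T" by (auto simp: Y_def)
  have "set Q = V - {a, b}" using cover C(2) \<open>Y = {b}\<close> by blast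
  then show "\<exists>Q. dpath E Q \<and> Q \<noteq> [] \<and> set Q = V - {a, b} \<and> hd Q = hd L \<and> last Q = last L"
    using Q by blast
qed

text \<open>An in-neighbour of \<open>a\<close> before an out-neighbour would bound a gap without
  neighbours of \<open>a\<close> that lies inside \<open>R\<close>, whereas
  \<open>reinsert_gap\<close> puts \<open>b\<close> into every such gap.\<close>

lemma order_on_cycle:
  assumes ab: "nonadj a b" and bad: "dg a + dg b + 2 \<le> 2 * card V"
    and C: "dcycle E (b # R)" "set (b # R) = V - {a}" and x: "E x a" and y: "E a y"
  shows "\<not> subseq [x, y] R"
proof
  assume "subseq [x, y] R"
  then obtain us vs ws where R: "R = us @ x # vs @ y # ws" using subseq_pairD by metis
  \<comment> \<open>First the earliest out-neighbour behind \<open>x\<close> is taken, then the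
    latest in-neighbour before it, so that nothing between the two is adjacent to
    \<open>a\<close>.\<close>
  obtain vs1 y' ws1 where s1: "vs @ y # ws = vs1 @ y' # ws1" "E a y'" "\<forall>v\<in>set vs1. \<not> E a v"
    using split_list_first_prop[of "vs @ y # ws" "E a"] y by auto
  obtain us1 x' vs2 where s2: "x # vs1 = us1 @ x' # vs2" "E x' a" "\<forall>v\<in>set vs2. \<not> E v a"
    using split_list_last_prop[of "x # vs1" "\<lambda>v. E v a"] x by auto
  have Req: "R = us @ us1 @ x' # vs2 @ y' # ws1"
    using R s1(1) s2(1) by (metis append.assoc append_Cons)
  have "set vs2 \<subseteq> set vs1" using s2(1) by (cases us1) auto
  let ?L = "y' # ws1 @ b # us @ us1 @ [x']"
  have "b \<in> set vs2"
  proof (rule reinsert_gap[OF ab bad, of ?L])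
    show "dcycle E (?L @ vs2)"
      using dcycle_rotate[of E "b # us @ us1 @ x' # vs2" "y' # ws1"] C(1) Req by simp
    show "set (?L @ vs2) = V - {a}" using C(2) Req by auto
    show "\<not> E a v \<and> \<not> E v a" if "v \<in> set vs2" for v using that s1 s2 \<open>set vs2 \<subseteq> set vs1\<close> by auto
  qed (use s1 s2 in auto)
  then show False using C(1) Req by (auto simp: dcycle_def dpath_def)
qed

text \<open>By \<open>order_on_cycle\<close> all neighbours of \<open>a\<close> lie between its
  first out-neighbour \<open>y\<close> and its last in-neighbour \<open>x\<close>. The rest of the
  cycle, which contains \<open>b\<close>, serves as the gap for \<open>reinsert_gap\<close>.\<close>

lemma path_through_rest:
  assumes ab: "nonadj a b" and bad: "dg a + dg b + 2 \<le> 2 * card V"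
    and C: "dcycle E (b # R)" "set (b # R) = V - {a}"
  obtains Q where "dpath E Q" "Q \<noteq> []" "set Q = V - {a, b}" "E a (hd Q)" "E (last Q) a"
proof -
  have V: "a \<in> V" "b \<in> V" "a \<noteq> b" "\<not> E a b" "\<not> E b a" using ab by (auto simp: nonadj_def)
  have R: "set R = V - {a, b}" using C by (auto simp: dcycle_def dpath_def)
  obtain y0 where "E a y0" "y0 \<noteq> b"
    using out_neighbour_avoiding[OF card_V strong_del[OF V(2)] V(1)] V by auto
  then have "y0 \<in> set R" using R E_in[of a y0] E_irrefl by auto
  then obtain R1 y R2 where s1: "R = R1 @ y # R2" "E a y" "\<forall>v\<in>set R1. \<not> E a v"
    using split_list_first_prop[of R "E a"] \<open>E a y0\<close> by auto
  have ord: "\<not> subseq [u, v] R" if "E u a" "E a v" for u v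
    using order_on_cycle[OF ab bad C that] .
  have R1: "\<not> E v a" if "v \<in> set R1" for v
  proof
    assume "E v a"
    have "subseq [v, y] (R1 @ (y # R2))" using \<open>v \<in> set R1\<close> by (intro subseq_pairI) auto
    then have "subseq [v, y] R" using s1 by simp
    then show False using ord[OF \<open>E v a\<close> s1(2)] by simp
  qed
  obtain x0 where "E x0 a" "x0 \<noteq> b"
    using in_neighbour_avoiding[OF card_V strong_del[OF V(2)] V(1)] V by auto
  then have "x0 \<in> set (y # R2)" using R E_in[of x0 a] E_irrefl R1[of x0] s1 by auto
  then obtain M1 x M2 where s2: "y # R2 = M1 @ x # M2" "E x a" "\<forall>v\<in>set M2. \<not> E v a"
    using split_list_last_prop[of "y # R2" "\<lambda>v. E v a"] \<open>E x0 a\<close> by auto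
  have M2: "\<not> E a v" if "v \<in> set M2" for v
  proof
    assume "E a v"
    have "subseq [x, v] ((R1 @ M1 @ [x]) @ M2)" using \<open>v \<in> set M2\<close> by (intro subseq_pairI) auto
    then have "subseq [x, v] R" using s1 s2 by simp
    then show False using ord[OF s2(2) \<open>E a v\<close>] by simp
  qed
  have hd: "hd (M1 @ [x]) = y" using s2(1) by (cases M1) auto
  have "\<exists>Q. dpath E Q \<and> Q \<noteq> [] \<and> set Q = V - {a, b} \<and> hd Q = hd (M1 @ [x]) \<and> last Q = last (M1 @ [x])"
  proof (rule reinsert_gap(2)[OF ab bad, of "M1 @ [x]" "M2 @ b # R1"])
    show "dcycle E ((M1 @ [x]) @ M2 @ b # R1)"
      using dcycle_rotate[of E "b # R1" "y # R2"] C(1) s1(1) s2(1) by simp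
    show "set ((M1 @ [x]) @ M2 @ b # R1) = V - {a}"
      using C(2) s1(1) arg_cong[OF s2(1), of set] by auto
    show "E a (hd (M1 @ [x]))" using hd s1 by simp
    show "\<not> E a v \<and> \<not> E v a" if "v \<in> set (M2 @ b # R1)" for v
      using that M2 s2 R1 s1 V by auto
  qed (use s2 in auto)
  then show ?thesis using that hd s1(2) s2(2) by auto
qed

end

section \<open>Paths closed by both vertices of the bad pair\<close>

text \<open>The set of assumptions is invariant under reversing all arcs. \<open>N\<close> consists of the insertable vertices.\<close>

locale hub_digraph = rel_digraph +
  fixes a b :: 'a and N :: "'a set"
  assumes card_V: "card V \<ge> 3"
    and strong_del: "v \<in> V \<Longrightarrow> out_closed_free (V - {v})"
    and not_ham: "\<not> (dcycle E C \<and> set C = V)"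
    and hubs: "nonadj a b"
    and N_sub: "N \<subseteq> V - {a, b}"
    and non_N: "z \<in> V - {a, b} - N \<Longrightarrow> (E a z \<or> E z a) \<and> (E b z \<or> E z b)"
    and N_nonadj: "t \<in> N \<Longrightarrow> (\<not> E a t \<and> \<not> E t a) \<or> (\<not> E b t \<and> \<not> E t b)"
    and N_deg: "t \<in> N \<Longrightarrow> dg t \<ge> card V + card N + 1"
    and many_non_N: "N = {} \<or> card (V - {a, b} - N) \<ge> 3"
    and order_a: "dpath E Q \<Longrightarrow> Q \<noteq> [] \<Longrightarrow> set Q = V - {a, b} \<Longrightarrow> E b (hd Q) \<Longrightarrow> E (last Q) b \<Longrightarrow>
      E x a \<Longrightarrow> E a y \<Longrightarrow> \<not> subseq [x, y] Q"
    and order_b: "dpath E Q \<Longrightarrow> Q \<noteq> [] \<Longrightarrow> set Q = V - {a, b} \<Longrightarrow> E a (hd Q) \<Longrightarrow> E (last Q) a \<Longrightarrow>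
      E x b \<Longrightarrow> E b y \<Longrightarrow> \<not> subseq [x, y] Q"
begin

abbreviation S where "S \<equiv> V - {a, b}"
abbreviation Z where "Z \<equiv> S - N"

lemma ab: "a \<in> V" "b \<in> V" "a \<noteq> b" "\<not> E a b" "\<not> E b a"
  using hubs by (auto simp: nonadj_def)

lemma finite_N: "finite N"
  using N_sub finite_V finite_subset by blast

lemma card_S: "card S + 2 = card V"
proof -
  have "card S = card V - card {a, b}" using ab finite_V by (intro card_Diff_subset) auto
  then show ?thesis using ab card_V by simp
qed

lemma deg_to_rest:
  assumes "W \<subseteq> N" "t \<in> W"
  shows "deg_in E W t + 2 \<le> 2 * card W"
proof -
  have fin: "finite W" using assms finite_N finite_subset by blast
  have "deg_in E W t = deg_in E (W - {t}) t"
    using deg_in_insert[of "W - {t}" t E t] fin assms E_irrefl by (simp add: insert_absorb)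
  also have "\<dots> \<le> 2 * card (W - {t})" using fin by (intro deg_in_le) auto
  finally show ?thesis using card_Suc_Diff1[OF fin assms(2)] by simp
qed

text \<open>At most 2 arcs join \<open>t\<close> to the hubs, and at most two join it to each other
  missing vertex, all of which lie in \<open>N\<close>. The bound \<open>N_deg\<close> leaves enough
  arcs to the path.\<close>

lemma insertable_path:
  assumes "dpath E R" "Z \<subseteq> set R" "set R \<subseteq> S" "t \<in> S - set R"
  shows "deg_in E (set R) t \<ge> length R + 2"
proof -
  define W where "W = S - set R"
  have W: "W \<subseteq> N" "t \<in> W" "finite W" using assms finite_V by (auto simp: W_def)
  have "card W \<le> card N" using W finite_N card_mono by blast
  have "card S = card (set R) + card W"
    using assms W finite_V by (subst card_Un_disjoint[symmetric]) (auto simp: W_def intro: arg_cong[of _ _ card])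
  then have len: "length R + card W + 2 = card V" using card_S assms(1) by (simp add: dpath_def distinct_card)
  have notin: "{a} \<inter> ({b} \<union> (set R \<union> W)) = {}" "{b} \<inter> (set R \<union> W) = {}" "set R \<inter> W = {}"
    using ab(3) assms(3) by (auto simp: W_def)
  have "V = {a} \<union> ({b} \<union> (set R \<union> W))" using ab(1,2) assms(3) by (auto simp: W_def)
  moreover have "deg_in E ({a} \<union> ({b} \<union> (set R \<union> W))) t
      = deg_in E {a} t + (deg_in E {b} t + (deg_in E (set R) t + deg_in E W t))"
    using notin W(3) by (simp only: deg_in_union finite.emptyI finite.insertI finite_Un List.finite_set simp_thms)
  ultimately have "dg t = deg_in E {a} t + (deg_in E {b} t + (deg_in E (set R) t + deg_in E W t))" by simp
  moreover have "deg_in E {a} t + deg_in E {b} t \<le> 2"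
    using N_nonadj[of t] W by (auto simp: deg_in_single)
  moreover have "dg t \<ge> card V + card N + 1" using N_deg W by blast
  ultimately show ?thesis using deg_to_rest[OF W(1,2)] len \<open>card W \<le> card N\<close> by linarith
qed

lemma extend_path:
  assumes "dpath E R" "R \<noteq> []" "Z \<subseteq> set R" "set R \<subseteq> S"
  obtains Q where "dpath E Q" "Q \<noteq> []" "set Q = S" "hd Q = hd R" "last Q = last R" "subseq R Q"
proof -
  have "finite (S - set R)" "(S - set R) \<inter> set R = {}" using finite_V by auto
  then obtain Q T' where Q: "T' \<subseteq> S - set R" "dpath E Q" "Q \<noteq> []" "set Q = set R \<union> T'" "hd Q = hd R"
      "last Q = last R" "subseq R Q" "\<forall>y\<in>S - set R - T'. deg_in E (set Q) y \<le> length Q + 1"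
    using maximal_insertion[OF assms(1,2), of "S - set R"] by auto
  have "set Q = S"
  proof (rule ccontr)
    assume "set Q \<noteq> S"
    moreover have "set Q \<subseteq> S" using Q(1,4) assms(4) by blast
    ultimately obtain y where "y \<in> S - set Q" by blast
    moreover from this have "deg_in E (set Q) y \<ge> length Q + 2" using Q assms by (intro insertable_path) auto
    moreover have "y \<in> S - set R - T'" using \<open>y \<in> S - set Q\<close> Q(4) by blast
    ultimately show False using Q(8)[rule_format, of y] by linarith
  qed
  then show ?thesis using Q that by blast
qed

text \<open>The missing vertices lie in \<open>N\<close> and can all be inserted by the same count,
  which yields a Hamiltonian cycle.\<close>

lemma no_spanning_cycle:
  assumes "dcycle E C" "Z \<subseteq> set C" "a \<in> set C" "b \<in> set C"
  shows False
proof -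
  have CV: "set C \<subseteq> V" using assms dcycle_subset by blast
  have C: "dpath E C" "C \<noteq> []" "E (last C) (hd C)" using assms(1) by (auto simp: dcycle_def)
  have "finite (V - set C)" "(V - set C) \<inter> set C = {}" using finite_V by auto
  then obtain Q T' where Q: "T' \<subseteq> V - set C" "dpath E Q" "Q \<noteq> []" "set Q = set C \<union> T'" "hd Q = hd C"
      "last Q = last C" "\<forall>y\<in>V - set C - T'. deg_in E (set Q) y \<le> length Q + 1"
    using maximal_insertion[OF C(1,2), of "V - set C"] by auto
  have "dcycle E Q" using Q C by (simp add: dcycle_def)
  then obtain t where t: "t \<in> V - set Q" using not_ham[of Q] Q CV by blast
  define W where "W = V - set Q"
  have W: "W \<subseteq> N" "t \<in> W" "finite W" using assms Q t finite_V by (auto simp: W_def)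
  have "card W \<le> card N" using W finite_N card_mono by blast
  have VQ: "V = set Q \<union> W" "set Q \<inter> W = {}" using Q CV by (auto simp: W_def)
  have "card V = card (set Q) + card W"
    using VQ W by (metis List.finite_set card_Un_disjoint)
  then have len: "length Q + card W = card V" using distinct_card[of Q] Q(2) by (simp add: dpath_def)
  have "dg t = deg_in E (set Q) t + deg_in E W t" using deg_in_union[of "set Q" W E t] VQ W by simp
  moreover have "deg_in E (set Q) t \<le> length Q + 1" using Q t by auto
  moreover have "dg t \<ge> card V + card N + 1" using N_deg W by blast
  ultimately show False using deg_to_rest[OF W(1,2)] len \<open>card W \<le> card N\<close> by linarith
qed

definition hub_pair :: "'a \<Rightarrow> 'a \<Rightarrow> bool" where
  "hub_pair X Y \<longleftrightarrow> (X = a \<and> Y = b) \<or> (X = b \<and> Y = a)"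

text \<open>\<open>extend_path\<close> keeps the ends and the order of \<open>R\<close>, so the
  order property of paths through all of \<open>S\<close> passes to paths that only cover
  \<open>Z\<close>.\<close>

lemma order_path:
  assumes "dpath E R" "R \<noteq> []" "Z \<subseteq> set R" "set R \<subseteq> S" "hub_pair X Y" "E X (hd R)" "E (last R) X"
    "E x Y" "E Y y"
  shows "\<not> subseq [x, y] R"
proof
  assume "subseq [x, y] R"
  obtain Q where Q: "dpath E Q" "Q \<noteq> []" "set Q = S" "hd Q = hd R" "last Q = last R" "subseq R Q"
    using extend_path[OF assms(1-4)] .
  have "subseq [x, y] Q" using \<open>subseq [x, y] R\<close> Q(6) by (rule subseq_order.trans)
  then show False using order_a[OF Q(1-3)] order_b[OF Q(1-3)] Q assms by (auto simp: hub_pair_def)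
qed

lemma hub_neighbour:
  assumes "X \<in> {a, b}"
  shows "\<exists>y\<in>S - {v}. E X y" "\<exists>y\<in>S - {v}. E y X"
proof -
  have in_S: "y \<in> S" if "E X y \<or> E y X" for y
    using that assms E_in ab E_irrefl by blast
  \<comment> \<open>The vertex to delete. If \<open>v\<close> is \<open>X\<close> or no vertex at
    all, the other hub is deleted instead, which is not adjacent to \<open>X\<close> anyway.\<close>
  define w where "w = (if v \<in> V \<and> v \<noteq> X then v else if X = a then b else a)"
  have w: "w \<in> V" "w \<noteq> X" using assms ab by (auto simp: w_def)
  have XV: "X \<in> V" using assms ab by auto
  obtain y where y: "y \<noteq> w" "E X y"
    using out_neighbour_avoiding[OF card_V strong_del[OF w(1)] XV w(2)] by blast
  then have "y \<in> S - {v}" using in_S[of y] assms by (auto simp: w_def split: if_splits)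
  then show "\<exists>y\<in>S - {v}. E X y" using y by blast
  obtain y where y: "y \<noteq> w" "E y X"
    using in_neighbour_avoiding[OF card_V strong_del[OF w(1)] XV w(2)] by blast
  then have "y \<in> S - {v}" using in_S[of y] assms by (auto simp: w_def split: if_splits)
  then show "\<exists>y\<in>S - {v}. E y X" using y by blast
qed

lemma Z_nonempty: "Z \<noteq> {}"
proof
  assume "Z = {}"
  then have "N = {}" using many_non_N by (metis card.empty not_numeral_le_zero)
  then show False using hub_neighbour(1)[of a a] \<open>Z = {}\<close> by auto
qed

text \<open>If the last vertex \<open>e\<close> before \<open>\<alpha>\<close> that is an out-neighbour of \<open>a\<close> or \<open>b\<close> is one of only \<open>X\<close>, then an
  earlier out-neighbour of the other hub \<open>Y\<close> can be moved behind \<open>\<alpha>\<close>, an in-neighbour of \<open>Y\<close>, on a path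
  closed by \<open>X\<close>.\<close>

lemma good_start:
  assumes Q: "dpath E Q" "Q \<noteq> []" "set Q = S" "E a (hd Q)" "E (last Q) a"
  obtains Q' where "dpath E Q'" "Q' \<noteq> []" "set Q' = S" "E a (hd Q')" "E b (hd Q')" "last Q' = last Q"
proof -
  have "\<exists>z\<in>set Q. z \<notin> N" using Z_nonempty Q(3) by blast
  then obtain B \<alpha> C where split: "Q = B @ \<alpha> # C" "\<alpha> \<notin> N" "\<forall>z\<in>set B. z \<in> N"
    using split_list_first_prop[of Q "\<lambda>z. z \<notin> N"] by blast
  have \<alpha>: "\<alpha> \<in> Z" using split Q by auto
  have ZC: "Z \<subseteq> set (\<alpha> # C)" using split Q by auto
  have ord: "\<not> subseq [x, y] Q" if "E x b" "E b y" for x y using order_b Q that by blast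
  have distQ: "distinct Q" using Q by (simp add: dpath_def)
  have hdQ: "hd Q \<in> set (B @ [\<alpha>])" using split by (cases B) auto
  \<comment> \<open>If \<open>b\<close> had out-neighbours only behind \<alpha>, then \<alpha>,
    being adjacent to \<open>b\<close>, would be an in-neighbour preceding one of them.\<close>
  have pre: "\<exists>t\<in>set (B @ [\<alpha>]). E Y t" if "Y \<in> {a, b}" for Y
  proof (cases "Y = a")
    case True
    then show ?thesis using hdQ Q by blast
  next
    case False
    then have Y: "Y = b" using that by auto
    obtain t where t: "t \<in> S" "E b t" using hub_neighbour(1)[of b b] by auto
    show ?thesis
    proof (rule ccontr)
      assume *: "\<not> ?thesis"
      then have "t \<in> set C" "E \<alpha> b" using t Q(3) split Y non_N[OF \<alpha>] by auto
      moreover have "subseq [\<alpha>, t] ((B @ [\<alpha>]) @ C)" using \<open>t \<in> set C\<close> by (intro subseq_pairI) auto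
      ultimately show False using ord t split by simp
    qed
  qed
  \<comment> \<open>For \<open>b\<close> the path is cut behind its last in-neighbour. What is cut
    off lies in \<open>N\<close>: a vertex of \<open>Z\<close> there would be an out-neighbour of
    \<open>b\<close> behind an in-neighbour.\<close>
  have ends: "\<exists>D D'. \<alpha> # C = D @ D' \<and> D \<noteq> [] \<and> E (last D) X \<and> Z \<subseteq> set D" if "X \<in> {a, b}" for X
  proof (cases "X = a")
    case True
    then show ?thesis using split Q ZC by (intro exI[of _ "\<alpha> # C"] exI[of _ "[]"]) auto
  next
    case False
    then have X: "X = b" using that by auto
    have "\<exists>z\<in>set (\<alpha> # C). E z b"
    proof (rule ccontr)
      assume *: "\<not> ?thesis"
      obtain x where x: "x \<in> S" "E x b" using hub_neighbour(2)[of b b] by auto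
      then have "x \<in> set B" "E b \<alpha>" using * Q(3) split non_N[OF \<alpha>] by auto
      moreover have "subseq [x, \<alpha>] (B @ (\<alpha> # C))" using \<open>x \<in> set B\<close> by (intro subseq_pairI) auto
      ultimately show False using ord x split by simp
    qed
    then obtain D x D' where D: "\<alpha> # C = D @ x # D'" "E x b" "\<forall>z\<in>set D'. \<not> E z b"
      using split_list_last_prop[of "\<alpha> # C" "\<lambda>z. E z b"] by blast
    have "z \<notin> Z" if z: "z \<in> set D'" for z
    proof
      assume "z \<in> Z"
      then have "E b z" using non_N D(3) z by blast
      moreover have "subseq [x, z] ((B @ D @ [x]) @ D')" using z by (intro subseq_pairI) auto
      ultimately show False using ord D split by simp
    qed
    moreover have "set (\<alpha> # C) = insert x (set D \<union> set D')" using arg_cong[OF D(1), of set] by auto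
    ultimately have "Z \<subseteq> set (D @ [x])" using ZC by auto
    then show ?thesis using D X by (intro exI[of _ "D @ [x]"] exI[of _ D']) auto
  qed
  have "\<exists>l\<in>set (B @ [\<alpha>]). E a l \<and> E b l"
  proof (rule ccontr)
    assume none: "\<not> ?thesis"
    have "\<exists>e\<in>set (B @ [\<alpha>]). E a e \<or> E b e" using pre by blast
    then obtain B1 e B2 where e: "B @ [\<alpha>] = B1 @ e # B2" "E a e \<or> E b e" "\<forall>z\<in>set B2. \<not> (E a z \<or> E b z)"
      using split_list_last_prop[of "B @ [\<alpha>]" "\<lambda>e. E a e \<or> E b e"] by blast
    have "e \<in> set (B @ [\<alpha>])" using e(1) by simp
    then obtain X Y where XY: "hub_pair X Y" "E X e" "\<not> E Y e"
      using e(2) none unfolding hub_pair_def by blast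
    then have XY': "X \<in> {a, b}" "Y \<in> {a, b}" by (auto simp: hub_pair_def)
    obtain t where t: "t \<in> set (B @ [\<alpha>])" "E Y t" using pre XY' by blast
    have "t \<in> set B1 \<union> insert e (set B2)" using t(1) arg_cong[OF e(1), of set] by auto
    then have tB1: "t \<in> set B1" using t(2) e(3) XY XY' by auto
    define K where "K = butlast (e # B2)"
    have "last (e # B2) = \<alpha>" using arg_cong[OF e(1), of last] by simp
    then have K: "e # B2 = K @ [\<alpha>]" unfolding K_def by (metis append_butlast_last_id list.distinct(1))
    obtain D D' where D: "\<alpha> # C = D @ D'" "D \<noteq> []" "E (last D) X" "Z \<subseteq> set D" using ends XY' by blast
    have Qeq: "Q = B1 @ K @ D @ D'" using split(1) e(1) K D(1)
      by (metis append.assoc append_Cons append_Nil)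
    have hdD: "hd D = \<alpha>" using D by (cases D) auto
    have "\<alpha> \<notin> set B1" using distQ Qeq D hdD hd_in_set[of D] by auto
    moreover have "\<alpha> \<in> set B1 \<union> insert e (set B2)" using arg_cong[OF e(1), of set] by auto
    ultimately have "\<not> E Y \<alpha>" using e(3) XY XY' by auto
    then have \<alpha>Y: "E \<alpha> Y" using non_N[OF \<alpha>] XY' by auto
    have path: "dpath E (B1 @ K @ D @ D')" using Q(1) Qeq by simp
    have sets: "set B1 \<union> (set K \<union> (set D \<union> set D')) = S" using Q(3) unfolding Qeq by simp
    have "set B1 \<inter> (set K \<union> (set D \<union> set D')) = {}" "dpath E D" "dpath E (K @ D)"
      using path unfolding dpath_append by auto
    moreover from this have "set D \<subseteq> S" "t \<in> S - set D" "t \<notin> set K" using sets tB1 by blast+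
    ultimately have "deg_in E (set D) t \<ge> length D + 2" using D(4) by (intro insertable_path) auto
    then obtain ys zs where ins: "D = ys @ zs" "ys \<noteq> []" "zs \<noteq> []" "E (last ys) t" "E t (hd zs)"
      using insertion_point[of D E t] \<open>dpath E D\<close> by (auto simp: dpath_def)
    \<comment> \<open>This path starts at \<open>e\<close>, hence is closed by \<open>X\<close>, and
      covers \<open>Z\<close>. It has \<alpha>, an in-neighbour of \<open>Y\<close>, before
      \<open>t\<close>, an out-neighbour of \<open>Y\<close>, against
      \<open>order_path\<close>.\<close>
    let ?R = "(K @ ys) @ t # zs"
    have "dpath E ?R"
      using \<open>dpath E (K @ D)\<close> ins \<open>t \<in> S - set D\<close> \<open>t \<notin> set K\<close> by (intro dpath_insert) auto
    moreover have "Z \<subseteq> set ?R" using D(4) ins(1) by auto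
    moreover have "set ?R \<subseteq> S" using sets ins(1) \<open>t \<in> S - set D\<close> by auto
    moreover have "hd ?R = e" using K ins hdD by (cases K) auto
    moreover have "last ?R = last D" using ins by auto
    ultimately have "\<not> subseq [\<alpha>, t] ?R"
      using XY D(3) \<alpha>Y t(2) by (intro order_path[where X = X and Y = Y]) simp_all
    moreover have "subseq [\<alpha>, t] ?R" using ins hdD by (intro subseq_pairI) (auto simp: hd_append)
    ultimately show False by simp
  qed
  \<comment> \<open>The part before \<open>l\<close> lies in \<open>N\<close>; it is cut off and its
    vertices are inserted behind \<open>l\<close>.\<close>
  then obtain l where l: "l \<in> set (B @ [\<alpha>])" "E a l" "E b l" by blast
  then obtain p q where pq: "B @ [\<alpha>] = p @ l # q" by (meson split_list)
  have Qeq: "Q = p @ (l # q @ C)" using pq split by (metis append.assoc append_Cons append_Nil)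
  have "set p \<subseteq> set B" using arg_cong[OF pq, of butlast] by (auto simp: butlast_append)
  moreover have "set p \<union> set (l # q @ C) = S" using Q(3) unfolding Qeq by simp
  ultimately have "Z \<subseteq> set (l # q @ C)" using split(3) by blast
  moreover have "dpath E (l # q @ C)" "set (l # q @ C) \<subseteq> S" using Qeq Q by (auto simp: dpath_append)
  ultimately obtain Q' where Q': "dpath E Q'" "Q' \<noteq> []" "set Q' = S" "hd Q' = hd (l # q @ C)"
    "last Q' = last (l # q @ C)" using extend_path[of "l # q @ C"] by blast
  show ?thesis
  proof (rule that[OF Q'(1-3)])
    show "last Q' = last Q" using Q'(5) Qeq by simp
  qed (use Q' l in auto)
qed

end

section \<open>Reversal of all arcs\<close>

lemma dpath_rev: "dpath (\<lambda>x y. E y x) (rev xs) \<longleftrightarrow> dpath E xs"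
  by (simp add: dpath_def)

lemma dcycle_rev: "dcycle (\<lambda>x y. E y x) (rev xs) \<longleftrightarrow> dcycle E xs"
  by (auto simp: dcycle_def dpath_rev hd_rev last_rev)

lemma dpath_upt:
  assumes "\<And>i. m \<le> i \<Longrightarrow> Suc i < n \<Longrightarrow> R i (Suc i)"
  shows "dpath R [m..<n]"
  using assms
proof (induction n)
  case (Suc n)
  show ?case
  proof (cases "m < n")
    case True
    then have "R (last [m..<n]) n" using Suc.prems[of "n - 1"] by simp
    then show ?thesis using Suc True by (simp add: dpath_append)
  qed (cases "m = n"; simp)
qed simp

context rel_digraph
begin

lemma converse_rel_digraph: "rel_digraph V (\<lambda>x y. E y x)"
  by unfold_locales (use finite_V E_in E_irrefl in auto)

lemma converse_nonadj: "rel_digraph.nonadj V (\<lambda>x y. E y x) x y \<longleftrightarrow> nonadj x y"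
  using rel_digraph.nonadj_def[OF converse_rel_digraph] by (auto simp: nonadj_def)

text \<open>A reversed arc leaving \<open>S\<close> is an arc leaving the complement of
  \<open>S\<close>.\<close>

lemma converse_out_closed_free:
  assumes "out_closed_free U"
  shows "rel_digraph.out_closed_free (\<lambda>x y. E y x) U"
  unfolding rel_digraph.out_closed_free_def[OF converse_rel_digraph]
proof (intro allI impI)
  fix S assume S: "S \<subseteq> U \<and> S \<noteq> {} \<and> S \<noteq> U"
  then have "U - S \<subseteq> U \<and> U - S \<noteq> {} \<and> U - S \<noteq> U" by blast
  then obtain x y where "x \<in> U - S" "y \<in> U - (U - S)" "E x y"
    using assms unfolding out_closed_free_def by metis
  then show "\<exists>x\<in>S. \<exists>y\<in>U - S. E y x" by blast
qed

end

context hub_digraph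
begin

text \<open>Reversal exchanges in- and out-neighbours of the hubs and also the direction of the
  path, so the two order properties are preserved.\<close>

lemma converse_hub_digraph: "hub_digraph V (\<lambda>x y. E y x) a b N"
proof -
  interpret conv: rel_digraph V "\<lambda>x y. E y x" by (rule converse_rel_digraph)
  show ?thesis
  proof unfold_locales
    show "card V \<ge> 3" by (rule card_V)
    show "conv.out_closed_free (V - {v})" if "v \<in> V" for v
      using converse_out_closed_free strong_del that by blast
    show "\<not> (dcycle (\<lambda>x y. E y x) C \<and> set C = V)" for C
      using not_ham[of "rev C"] dcycle_rev[of E "rev C"] by simp
    show "conv.nonadj a b" using hubs converse_nonadj by simp
    show "card V + card N + 1 \<le> deg_in (\<lambda>x y. E y x) V t" if "t \<in> N" for t
      using N_deg[OF that] by (simp only: deg_in_converse[of E])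
    have sub: "subseq [y, x] (rev Q)" if xy: "subseq [x, y] Q" for x y and Q :: "'a list"
    proof -
      obtain us vs ws where "Q = us @ x # vs @ y # ws" using subseq_pairD[OF xy] by blast
      then show ?thesis using subseq_pairI[of y "rev ws @ [y]" x "rev vs @ x # rev us"] by simp
    qed
    show "\<not> subseq [x, y] Q"
      if "dpath (\<lambda>x y. E y x) Q" "Q \<noteq> []" "set Q = V - {a, b}" "E (hd Q) b" "E b (last Q)" "E a x" "E y a" for Q x y
    proof -
      have "dpath E (rev Q)" using that(1) dpath_rev[of E "rev Q"] by simp
      then have "\<not> subseq [y, x] (rev Q)"
        by (rule order_a) (use that in \<open>simp_all add: hd_rev last_rev\<close>)
      then show ?thesis using sub by blast
    qed
    show "\<not> subseq [x, y] Q"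
      if "dpath (\<lambda>x y. E y x) Q" "Q \<noteq> []" "set Q = V - {a, b}" "E (hd Q) a" "E a (last Q)" "E b x" "E y b" for Q x y
    proof -
      have "dpath E (rev Q)" using that(1) dpath_rev[of E "rev Q"] by simp
      then have "\<not> subseq [y, x] (rev Q)"
        by (rule order_b) (use that in \<open>simp_all add: hd_rev last_rev\<close>)
      then show ?thesis using sub by blast
    qed
  qed (use N_sub non_N N_nonadj many_non_N in auto)
qed

text \<open>\<open>good_start\<close> repairs the start and keeps the end; applied again to the
  reversed digraph it repairs the end and keeps the start.\<close>

lemma good_path:
  assumes "dpath E Q" "Q \<noteq> []" "set Q = S" "E a (hd Q)" "E (last Q) a"
  obtains Q' where "dpath E Q'" "Q' \<noteq> []" "set Q' = S" "E a (hd Q')" "E b (hd Q')"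
    "E (last Q') a" "E (last Q') b"
proof -
  interpret conv: hub_digraph V "\<lambda>x y. E y x" a b N by (rule converse_hub_digraph)
  obtain Q1 where Q1: "dpath E Q1" "Q1 \<noteq> []" "set Q1 = S" "E a (hd Q1)" "E b (hd Q1)" "last Q1 = last Q"
    using good_start[OF assms] .
  obtain Q2 where Q2: "dpath (\<lambda>x y. E y x) Q2" "Q2 \<noteq> []" "set Q2 = S" "E (hd Q2) a" "E (hd Q2) b"
    "last Q2 = last (rev Q1)"
    using conv.good_start[of "rev Q1"] Q1 assms(5) by (auto simp: dpath_rev hd_rev last_rev)
  show ?thesis
    using Q1 Q2 dpath_rev[of E "rev Q2"] by (intro that[of "rev Q2"]) (auto simp: hd_rev last_rev)
qed

end

section \<open>Disjoint paths made of steps and jumps over positions\<close>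

locale crossing_path =
  fixes R :: "nat \<Rightarrow> nat \<Rightarrow> bool" and s :: nat
  assumes step: "Suc i < s \<Longrightarrow> R i (Suc i)"
    and cross: "0 < x \<Longrightarrow> Suc x < s \<Longrightarrow> \<exists>i j. i < x \<and> x < j \<and> j < s \<and> R i j"
begin

text \<open>Two disjoint paths \<open>A\<close> and \<open>B @ [j0]\<close>; the first is about to jump to \<open>j\<close>, the farthest
  position reachable from below \<open>j0\<close>, and the second will run on from \<open>j0\<close> towards \<open>j\<close>.\<close>

definition frontier :: "nat list \<Rightarrow> nat list \<Rightarrow> nat \<Rightarrow> nat \<Rightarrow> bool" where
  "frontier A B j0 j \<longleftrightarrow> A \<noteq> [] \<and> dpath R A \<and> dpath R (B @ [j0]) \<and> set A \<subseteq> {..<j0} \<and> set B \<subseteq> {..<j0} \<and>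
     set A \<inter> set B = {} \<and> R (last A) j \<and> j0 < j \<and> j < s \<and> (\<forall>i'<j0. \<forall>j'<s. R i' j' \<longrightarrow> j' \<le> j)"

lemma farthest:
  assumes "0 < x" "Suc x < s"
  obtains i j where "i < x" "x < j" "j < s" "R i j" "\<forall>i'<x. \<forall>j'<s. R i' j' \<longrightarrow> j' \<le> j"
proof -
  define F where "F = {j. j < s \<and> (\<exists>i<x. R i j)}"
  have fin: "finite F" by (simp add: F_def)
  obtain i j where ij: "i < x" "x < j" "j < s" "R i j" using cross assms by blast
  then have "j \<in> F" by (auto simp: F_def)
  then have "Max F \<in> F" "j \<le> Max F" using fin by (auto intro: Max_in)
  then obtain i' where "i' < x" "R i' (Max F)" "Max F < s" by (auto simp: F_def)
  moreover have "\<forall>i'<x. \<forall>j'<s. R i' j' \<longrightarrow> j' \<le> Max F"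
    using Max_ge[OF fin] unfolding F_def by blast
  ultimately show ?thesis using that[of i' "Max F"] ij \<open>j \<le> Max F\<close> by auto
qed

text \<open>The second path runs from \<open>j0\<close> to the origin \<open>i'\<close> of a
  farthest jump over \<open>j\<close>, while the first one jumps to \<open>j\<close>. Thereby the
  two paths exchange their roles.\<close>

lemma frontier_step:
  assumes fr: "frontier A B j0 j" and j: "Suc j < s"
  obtains A' j' where "frontier A' A j j'" "hd A' = hd (B @ [j0])" "insert j0 (set B) \<subseteq> set A'"
proof -
  have F: "A \<noteq> []" "dpath R A" "dpath R (B @ [j0])" "set A \<subseteq> {..<j0}" "set B \<subseteq> {..<j0}" "set A \<inter> set B = {}"
     "R (last A) j" "j0 < j" "j < s" "\<forall>i'<j0. \<forall>j'<s. R i' j' \<longrightarrow> j' \<le> j"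
    using fr unfolding frontier_def by blast+
  obtain i' j' where ij: "i' < j" "j < j'" "j' < s" "R i' j'" "\<forall>i<j. \<forall>k<s. R i k \<longrightarrow> k \<le> j'"
    using farthest[of j] F(8) j by auto
  \<comment> \<open>Jumps from below \<open>j0\<close> reach at most \<open>j\<close>, so a jump
    beyond \<open>j\<close> starts at \<open>j0\<close> or later.\<close>
  have "j0 \<le> i'" using F(10) ij by (meson leD not_le)
  define A' where "A' = B @ [j0..<Suc i']"
  have up: "[j0..<Suc i'] = j0 # [Suc j0..<Suc i']" using \<open>j0 \<le> i'\<close> by (simp add: upt_conv_Cons)
  have "dpath R [j0..<Suc i']" using step ij F by (intro dpath_upt) auto
  then have "dpath R A'" using F(3,5) unfolding A'_def dpath_append up by auto
  moreover have "A' \<noteq> []" using up by (simp add: A'_def)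
  moreover have "dpath R (A @ [j])" using F by (auto simp: dpath_append)
  moreover have "set A \<subseteq> {..<j}" "set A' \<subseteq> {..<j}" using F ij by (auto simp: A'_def)
  moreover have "set A' \<inter> set A = {}" using F by (auto simp: A'_def)
  moreover have "last A' = i'" using \<open>j0 \<le> i'\<close> by (simp add: A'_def)
  ultimately have "frontier A' A j j'" unfolding frontier_def using ij by blast
  moreover have "hd A' = hd (B @ [j0])" unfolding A'_def up by (cases B) auto
  moreover have "insert j0 (set B) \<subseteq> set A'" using \<open>j0 \<le> i'\<close> by (auto simp: A'_def)
  ultimately show ?thesis using that by blast
qed

text \<open>\<open>frontier_step\<close> is iterated until the pending jump passes \<open>y\<close>.
  The final disjunction records the parity of the number of role exchanges; an odd number needs at
  least one step, hence \<open>j \<le> y\<close>.\<close>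

lemma linkage:
  assumes "frontier A B j0 j" "j0 \<le> y" "Suc y < s"
  shows "\<exists>A' B' j0' j'. frontier A' B' j0' j' \<and> j0' \<le> y \<and> y < j' \<and>
    insert j0 (set A \<union> set B) \<subseteq> insert j0' (set A' \<union> set B') \<and>
    (hd A' = hd A \<and> hd (B' @ [j0']) = hd (B @ [j0]) \<or>
     hd A' = hd (B @ [j0]) \<and> hd (B' @ [j0']) = hd A \<and> j \<le> y)"
  using assms
proof (induction "s - j" arbitrary: A B j0 j rule: less_induct)
  case less
  show ?case
  proof (cases "y < j")
    case True
    then show ?thesis using less.prems by blast
  next
    case False
    then have "Suc j < s" using less.prems by simp
    then obtain A1 j1 where A1: "frontier A1 A j j1" "hd A1 = hd (B @ [j0])" "insert j0 (set B) \<subseteq> set A1"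
      using frontier_step less.prems(1) by metis
    have "j < j1" "j1 < s" using A1(1) by (auto simp: frontier_def)
    then have "s - j1 < s - j" by simp
    then obtain A' B' j0' j' where IH: "frontier A' B' j0' j'" "j0' \<le> y" "y < j'"
        "insert j (set A1 \<union> set A) \<subseteq> insert j0' (set A' \<union> set B')"
        "hd A' = hd A1 \<and> hd (B' @ [j0']) = hd (A @ [j]) \<or> hd A' = hd (A @ [j]) \<and> hd (B' @ [j0']) = hd A1 \<and> j1 \<le> y"
      using less.hyps[OF _ A1(1) _ less.prems(3)] False by (metis not_less)
    have "hd (A @ [j]) = hd A" using less.prems(1) by (simp add: frontier_def)
    then have "hd A' = hd A \<and> hd (B' @ [j0']) = hd (B @ [j0]) \<or>
        hd A' = hd (B @ [j0]) \<and> hd (B' @ [j0']) = hd A \<and> j \<le> y"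
      using IH(5) A1(2) False by (metis not_less)
    moreover have "insert j0 (set A \<union> set B) \<subseteq> insert j0' (set A' \<union> set B')" using A1(3) IH(4) by blast
    ultimately show ?thesis using IH(1-3) by blast
  qed
qed

end

section \<open>Two disjoint paths along the path\<close>

locale hub_path = hub_digraph +
  fixes Q :: "'a list"
  assumes Q: "dpath E Q" "Q \<noteq> []" "set Q = V - {a, b}"
    and Q_start: "X \<in> {a, b} \<Longrightarrow> E X (hd Q)"
    and Q_end: "X \<in> {a, b} \<Longrightarrow> E (last Q) X"
begin

abbreviation s where "s \<equiv> length Q"

lemma distinct_Q: "distinct Q"
  using Q by (simp add: dpath_def)

lemma nth_0: "X \<in> {a, b} \<Longrightarrow> E X (Q ! 0)"
  using Q_start Q(2) by (simp add: hd_conv_nth)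

lemma nth_last: "X \<in> {a, b} \<Longrightarrow> E (Q ! (s - 1)) X"
  using Q_end Q(2) by (simp add: last_conv_nth)

lemma nth_S: "i < s \<Longrightarrow> Q ! i \<in> S"
  using Q(3) nth_mem by blast

lemma order_nth:
  assumes X: "X \<in> {a, b}" and ij: "i < s" "j < s" and arcs: "E (Q ! i) X" "E X (Q ! j)"
  shows "j \<le> i"
proof (rule ccontr)
  assume "\<not> j \<le> i"
  have "Q ! i \<in> set (take (Suc i) Q)" using ij(1) by (simp add: take_Suc_conv_app_nth)
  moreover have "Q ! j \<in> set (drop (Suc i) Q)"
    using \<open>\<not> j \<le> i\<close> ij by (auto simp: in_set_conv_nth intro!: exI[of _ "j - Suc i"])
  ultimately have "subseq [Q ! i, Q ! j] (take (Suc i) Q @ drop (Suc i) Q)" by (rule subseq_pairI)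
  then have "subseq [Q ! i, Q ! j] Q" by simp
  then show False
    using order_a[OF Q Q_start Q_end] order_b[OF Q Q_start Q_end] X arcs by auto
qed

lemma hub_index:
  assumes "X \<in> {a, b}"
  shows "\<exists>i. 0 < i \<and> i < s \<and> E X (Q ! i)" "\<exists>i. Suc i < s \<and> E (Q ! i) X"
proof -
  obtain y where y: "y \<in> S - {Q ! 0}" "E X y" using hub_neighbour(1)[OF assms] by blast
  then obtain i where "i < s" "y = Q ! i" using Q(3) by (metis DiffE in_set_conv_nth)
  then show "\<exists>i. 0 < i \<and> i < s \<and> E X (Q ! i)" using y by (metis DiffD2 gr0I singletonI)
  obtain y where y: "y \<in> S - {Q ! (s - 1)}" "E y X" using hub_neighbour(2)[OF assms] by blast
  then obtain i where i: "i < s" "y = Q ! i" using Q(3) by (metis DiffE in_set_conv_nth)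
  then have "i \<noteq> s - 1" using y by blast
  then show "\<exists>i. Suc i < s \<and> E (Q ! i) X" using y i by (intro exI[of _ i]) auto
qed

text \<open>If no arc jumped over \<open>x\<close>, no arc could leave the earlier vertices after
  deletion of \<open>Q ! x\<close>, except through a hub; a detour through a hub contradicts the
  order of its neighbours.\<close>

sublocale crossing_path "\<lambda>i j. E (Q ! i) (Q ! j)" s
proof
  show "E (Q ! i) (Q ! Suc i)" if "Suc i < s" for i
    using Q(1) that by (simp add: dpath_def successively_conv_nth)
  fix x assume x: "0 < x" "Suc x < s"
  show "\<exists>i j. i < x \<and> x < j \<and> j < s \<and> E (Q ! i) (Q ! j)"
  proof (rule ccontr)
    assume none: "\<not> ?thesis"
    \<comment> \<open>The vertices before \<open>x\<close> and the hubs that they reach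
      directly.\<close>
    define A where "A = {Q ! i | i. i < x} \<union> {X \<in> {a, b}. \<exists>i<x. E (Q ! i) X}"
    define U where "U = V - {Q ! x}"
    have inj: "Q ! i = Q ! j \<longleftrightarrow> i = j" if "i < s" "j < s" for i j
      using that distinct_Q nth_eq_iff_index_eq by blast
    have QV: "Q ! i \<in> V" "Q ! i \<noteq> a" "Q ! i \<noteq> b" if "i < s" for i using nth_S[OF that] by auto
    have "Q ! x \<in> V" "Q ! x \<notin> {a, b}" using QV x by auto
    have "A \<subseteq> U"
    proof
      fix v assume "v \<in> A"
      then consider i where "i < x" "v = Q ! i" | "v \<in> {a, b}" unfolding A_def by blast
      then show "v \<in> U"
      proof cases
        case 1
        then show ?thesis using inj[of i x] QV[of i] x by (auto simp: U_def)
      next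
        case 2
        then show ?thesis using ab \<open>Q ! x \<notin> {a, b}\<close> by (auto simp: U_def)
      qed
    qed
    moreover have "Q ! 0 \<in> A" using x by (auto simp: A_def)
    moreover have "Q ! (s - 1) \<in> U - A"
    proof -
      have "Q ! (s - 1) \<noteq> Q ! i" if "i < x" for i using inj[of "s - 1" i] that x by auto
      then have "Q ! (s - 1) \<notin> A" using QV[of "s - 1"] x unfolding A_def by auto
      moreover have "Q ! (s - 1) \<in> U" using inj[of "s - 1" x] QV[of "s - 1"] x by (auto simp: U_def)
      ultimately show ?thesis by blast
    qed
    ultimately have "A \<subseteq> U \<and> A \<noteq> {} \<and> A \<noteq> U" by blast
    then obtain u w where uw: "u \<in> A" "w \<in> U - A" "E u w"
      using strong_del[OF \<open>Q ! x \<in> V\<close>] unfolding out_closed_free_def U_def by blast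
    show False
    proof (cases "w \<in> {a, b}")
      case True
      then have "u \<notin> {a, b}" using uw ab E_irrefl by blast
      then obtain i where "i < x" "u = Q ! i" using uw(1) unfolding A_def by blast
      then show False using uw True unfolding A_def by blast
    next
      case False
      then have "w \<in> set Q" using uw(2) Q(3) unfolding U_def by blast
      then obtain j where j: "j < s" "w = Q ! j" by (auto simp: in_set_conv_nth)
      have "x < j" using uw(2) j unfolding A_def U_def by (metis (mono_tags, lifting) DiffE UnI1 linorder_neqE_nat mem_Collect_eq singletonI)
      have "u \<in> {a, b}"
      proof (rule ccontr)
        assume "u \<notin> {a, b}"
        then obtain i where "i < x" "u = Q ! i" using uw(1) unfolding A_def by blast
        then show False using none uw(3) j \<open>x < j\<close> by blast
      qed
      then have "u \<noteq> Q ! i" if "i < x" for i using QV[of i] that x by auto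
      then obtain i where "i < x" "E (Q ! i) u" using uw(1) unfolding A_def by blast
      then have "j \<le> i" using order_nth[OF \<open>u \<in> {a, b}\<close>, of i j] uw(3) j x by simp
      then show False using \<open>i < x\<close> \<open>x < j\<close> by simp
    qed
  qed
qed

lemma dpath_map_nth:
  assumes "dpath (\<lambda>i j. E (Q ! i) (Q ! j)) A" "set A \<subseteq> {..<s}"
  shows "dpath E (map ((!) Q) A)"
proof -
  have "inj_on ((!) Q) (set A)" using assms(2) distinct_Q by (intro inj_on_nth) auto
  then show ?thesis using assms(1) by (simp add: dpath_def successively_map distinct_map)
qed

text \<open>\<open>A\<close>, \<open>X\<close>, \<open>B\<close>, \<open>Y\<close> in this order
  form a cycle, which \<open>no_spanning_cycle\<close> excludes.\<close>

lemma no_two_path_cover: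
  assumes AB: "dpath (\<lambda>i j. E (Q ! i) (Q ! j)) A" "dpath (\<lambda>i j. E (Q ! i) (Q ! j)) B" "A \<noteq> []" "B \<noteq> []"
      "set A \<union> set B \<subseteq> {..<s}" "set A \<inter> set B = {}"
    and XY: "hub_pair X Y" "E (Q ! last A) X" "E X (Q ! hd B)" "E (Q ! last B) Y" "E Y (Q ! hd A)"
    and cover: "\<And>l. l < s \<Longrightarrow> l \<notin> set A \<union> set B \<Longrightarrow> Q ! l \<in> N"
  shows False
proof -
  let ?A = "map ((!) Q) A" and ?B = "map ((!) Q) B"
  have d: "dpath E ?A" "dpath E ?B" using AB by (auto intro: dpath_map_nth)
  have "inj_on ((!) Q) (set A \<union> set B)" using AB distinct_Q by (intro inj_on_nth) auto
  then have disj: "set ?A \<inter> set ?B = {}" using AB(6)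
    by (simp add: inj_on_image_Int[of "(!) Q" "set A \<union> set B", symmetric])
  have sub: "set ?A \<subseteq> S" "set ?B \<subseteq> S" using AB(5) nth_S by auto
  have "X \<in> {a, b}" "Y \<in> {a, b}" "X \<noteq> Y" "{X, Y} = {a, b}" using XY(1) ab by (auto simp: hub_pair_def)
  then have notin: "X \<notin> set ?A \<union> set ?B" "Y \<notin> set ?A \<union> set ?B" using sub by blast+
  have "dcycle E (?A @ X # ?B @ [Y])"
    using d disj notin XY \<open>X \<noteq> Y\<close> AB(3,4) unfolding dcycle_def dpath_append dpath_Cons
    by (auto simp: last_map hd_map hd_append)
  moreover have "Z \<subseteq> set (?A @ X # ?B @ [Y])"
  proof
    fix z assume z: "z \<in> Z"
    then obtain l where "l < s" "z = Q ! l" using Q(3) by (metis DiffD1 in_set_conv_nth)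
    then show "z \<in> set (?A @ X # ?B @ [Y])" using cover[of l] z by auto
  qed
  moreover have "a \<in> set (?A @ X # ?B @ [Y])" "b \<in> set (?A @ X # ?B @ [Y])"
    using \<open>{X, Y} = {a, b}\<close> by auto
  ultimately show False by (rule no_spanning_cycle)
qed

text \<open>One of the two paths starts at position \<open>0\<close>, one ends at position \<open>s - 1\<close>; it is not known whether these
  are the same path. Unless \<open>x = y\<close>, the assumption \<open>flex\<close> provides for both cases.\<close>

lemma no_linkage:
  assumes XY: "hub_pair X Y"
    and st: "\<And>l. st l \<Longrightarrow> E Y (Q ! l)" and en: "\<And>l. en l \<Longrightarrow> E (Q ! l) X"
    and xy: "st x" "en y" "0 < x" "x \<le> y" "Suc y < s"
    and flex: "x = y \<or> (\<forall>l. st l \<longrightarrow> E X (Q ! l)) \<or> (\<forall>l. en l \<longrightarrow> E (Q ! l) Y)"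
    and C1: "\<And>l. l < x \<Longrightarrow> \<not> st l \<Longrightarrow> Q ! l \<in> N"
    and C2: "\<And>l. x < l \<Longrightarrow> l < y \<Longrightarrow> Q ! l \<in> N"
    and C3: "\<And>l. y < l \<Longrightarrow> l < s \<Longrightarrow> \<not> en l \<Longrightarrow> Q ! l \<in> N"
  shows False
proof -
  let ?R = "\<lambda>i j. E (Q ! i) (Q ! j)"
  have XYab: "X \<in> {a, b}" "Y \<in> {a, b}" using XY by (auto simp: hub_pair_def)
  have YX: "hub_pair Y X" using XY by (auto simp: hub_pair_def)
  obtain i j where ij: "i < x" "x < j" "j < s" "?R i j" "\<forall>i'<x. \<forall>j'<s. ?R i' j' \<longrightarrow> j' \<le> j"
    using farthest[of x] xy by auto
  \<comment> \<open>The first path runs from \<open>0\<close> to \<open>i\<close>, the second from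
    \<open>l0\<close> to \<open>x\<close>. Positions skipped between \<open>i\<close> and
    \<open>l0\<close> fail \<open>st\<close>, so \<open>C1\<close> puts them into
    \<open>N\<close>.\<close>
  define l0 where "l0 = (LEAST l. i < l \<and> st l)"
  have l0: "i < l0" "st l0" "l0 \<le> x"
    using LeastI[of "\<lambda>l. i < l \<and> st l" x] Least_le[of "\<lambda>l. i < l \<and> st l" x] ij(1) xy(1)
    unfolding l0_def by auto
  have l0_min: "\<not> st l" if "i < l" "l < l0" for l
    using not_less_Least[of l "\<lambda>l. i < l \<and> st l"] that unfolding l0_def by blast
  have "dpath ?R [0..<Suc i]" "dpath ?R [l0..<Suc x]" using step ij by (auto intro!: dpath_upt simp del: upt_Suc)
  moreover have "[l0..<Suc x] = [l0..<x] @ [x]" using l0 by simp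
  ultimately have "frontier [0..<Suc i] [l0..<x] x j"
    unfolding frontier_def using ij l0 by auto
  then obtain A B j0 j' where F: "frontier A B j0 j'" "j0 \<le> y" "y < j'"
    and cov: "insert x (set [0..<Suc i] \<union> set [l0..<x]) \<subseteq> insert j0 (set A \<union> set B)"
    and par: "hd A = hd [0..<Suc i] \<and> hd (B @ [j0]) = hd ([l0..<x] @ [x]) \<or>
     hd A = hd ([l0..<x] @ [x]) \<and> hd (B @ [j0]) = hd [0..<Suc i] \<and> j \<le> y"
    using linkage[OF _ xy(4,5)] by blast
  have f: "A \<noteq> []" "dpath ?R A" "dpath ?R (B @ [j0])" "set A \<subseteq> {..<j0}" "set B \<subseteq> {..<j0}" "set A \<inter> set B = {}"
     "?R (last A) j'" "j0 < j'" "j' < s"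
    using F(1) unfolding frontier_def by blast+
  have hds: "hd [0..<Suc i] = 0" "hd ([l0..<x] @ [x]) = l0"
    using l0 by (auto simp: hd_append upt_rec simp del: upt_Suc)
  \<comment> \<open>The path ending in \<open>j0\<close> runs on to the last end position before
    \<open>j'\<close>, the other one jumps to \<open>j'\<close> and runs to \<open>s - 1\<close>.
    Positions skipped between \<open>e\<close> and \<open>j'\<close> fail \<open>en\<close>, so
    \<open>C3\<close> applies.\<close>
  define e where "e = Max {l. l < j' \<and> en l}"
  have "e \<in> {l. l < j' \<and> en l}" "y \<le> e"
    unfolding e_def using F(3) xy(2) by (intro Max_in Max_ge; auto)+
  then have e: "e < j'" "en e" "y \<le> e" by auto
  have e_max: "l \<le> e" if "l < j'" "en l" for l
    unfolding e_def using that by (intro Max_ge) auto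
  define A' where "A' = A @ [j'..<s]"
  define B' where "B' = B @ [j0..<Suc e]"
  have up: "[j'..<s] = j' # [Suc j'..<s]" "[j0..<Suc e] = j0 # [Suc j0..<Suc e]"
    using f(9) F(2) e by (auto simp: upt_conv_Cons simp del: upt_Suc)
  have "dpath ?R [j'..<s]" "dpath ?R [j0..<Suc e]"
    using step e f(9) by (auto intro!: dpath_upt simp del: upt_Suc)
  then have paths: "dpath ?R A'" "dpath ?R B'"
    using f(2-5,7,8) unfolding A'_def B'_def dpath_append up by auto
  have ne: "A' \<noteq> []" "B' \<noteq> []" using up by (auto simp: A'_def B'_def)
  have sets: "set A' \<union> set B' \<subseteq> {..<s}" "set A' \<inter> set B' = {}"
    using f e by (auto simp: A'_def B'_def simp del: upt_Suc)
  have hdl: "hd A' = hd A" "hd B' = hd (B @ [j0])" "last A' = s - 1" "last B' = e"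
    using f(1,9) F(2) e unfolding A'_def B'_def by (auto simp: up hd_append last_append simp del: upt_Suc)
  have cover: "Q ! l \<in> N" if l: "l < s" "l \<notin> set A' \<union> set B'" for l
  proof -
    have sup: "insert j0 (set A \<union> set B) \<subseteq> set A' \<union> set B'" by (auto simp: A'_def B'_def up simp del: upt_Suc)
    have "l \<notin> insert x (set [0..<Suc i] \<union> set [l0..<x])"
      using subset_trans[OF cov sup] l(2) by blast
    then have "l \<noteq> x" "\<not> l \<le> i" "\<not> (l0 \<le> l \<and> l < x)" by (auto simp del: upt_Suc)
    then consider "i < l" "l < l0" | "x < l" "l < y" | "x < l" "y \<le> l" by linarith
    then show ?thesis
    proof cases
      case 1
      then show ?thesis using C1[of l] l0_min[of l] l0 by simp
    next
      case 2
      then show ?thesis using C2 by simp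
    next
      case 3
      have "\<not> j' \<le> l" using l by (auto simp: A'_def)
      moreover have "\<not> (j0 \<le> l \<and> l \<le> e)" using l(2) by (auto simp: B'_def)
      ultimately have "l < j'" "e < l" using 3 F(2) by auto
      then show ?thesis using C3[of l] e e_max[of l] l(1) by auto
    qed
  qed
  note two_paths = no_two_path_cover[OF paths ne sets _ _ _ _ _ cover]
  have lastA: "E (Q ! last A') X" "E (Q ! last A') Y" unfolding hdl using nth_last XYab by auto
  have lastB: "E (Q ! last B') X" unfolding hdl using en e(2) by blast
  from par have "hd A' = 0 \<and> hd B' = l0 \<or> hd A' = l0 \<and> hd B' = 0 \<and> j \<le> y" unfolding hds hdl .
  then show False
  proof
    assume "hd A' = 0 \<and> hd B' = l0"
    then show False
      using two_paths[OF YX lastA(2) _ lastB] st[OF l0(2)] nth_0[OF XYab(1)] by simp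
  next
    assume p: "hd A' = l0 \<and> hd B' = 0 \<and> j \<le> y"
    \<comment> \<open>An exchange of roles occurred, so the first jump over \<open>x\<close> ended
      at or before \<open>y\<close>. Only here is \<open>flex\<close> needed, to assign the hubs to
      the exchanged starts.\<close>
    then have "x \<noteq> y" using ij by auto
    then consider "\<forall>l. st l \<longrightarrow> E X (Q ! l)" | "\<forall>l. en l \<longrightarrow> E (Q ! l) Y" using flex by blast
    then show False
    proof cases
      case 1
      then show False
        using two_paths[OF YX lastA(2) _ lastB] nth_0[OF XYab(2)] l0(2) p by simp
    next
      case 2
      then have "E (Q ! last B') Y" unfolding hdl using e(2) by blast
      then show False
        using two_paths[OF XY lastA(1)] nth_0[OF XYab(1)] st[OF l0(2)] p by simp
    qed
  qed
qed

lemma Z_cases: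
  assumes "l < s" "Q ! l \<notin> N"
  shows "E a (Q ! l) \<or> E (Q ! l) a" "E b (Q ! l) \<or> E (Q ! l) b"
  using non_N[of "Q ! l"] nth_S[OF assms(1)] assms(2) by auto

text \<open>\<open>no_linkage\<close> applies with both cut positions at \<open>l\<close>. By the
  order of neighbours, vertices of \<open>Z\<close> before \<open>l\<close> are out-neighbours of
  \<open>Y\<close>, and those behind \<open>l\<close> are in-neighbours of \<open>X\<close>.\<close>

lemma no_common_in_out:
  assumes XY: "hub_pair X Y" and l: "l < s" "E (Q ! l) X"
  shows "\<not> E Y (Q ! l)"
proof
  assume Yl: "E Y (Q ! l)"
  have X: "X \<in> {a, b}" and Y: "Y \<in> {a, b}" using XY by (auto simp: hub_pair_def)
  obtain i where "0 < i" "i < s" "E X (Q ! i)" using hub_index(1)[OF X] by blast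
  then have "0 < l" using order_nth[OF X l(1) _ l(2), of i] by simp
  obtain i where "Suc i < s" "E (Q ! i) Y" using hub_index(2)[OF Y] by blast
  then have "Suc l < s" using order_nth[OF Y _ l(1) _ Yl, of i] by simp
  have nN: "(E X (Q ! k) \<or> E (Q ! k) X) \<and> (E Y (Q ! k) \<or> E (Q ! k) Y)" if "k < s" "Q ! k \<notin> N" for k
    using Z_cases[OF that] XY by (auto simp: hub_pair_def)
  show False
  proof (rule no_linkage[OF XY, of "\<lambda>k. E Y (Q ! k)" "\<lambda>k. E (Q ! k) X" l l])
    show "Q ! k \<in> N" if "k < l" "\<not> E Y (Q ! k)" for k
      using nN[of k] order_nth[OF Y _ l(1) _ Yl, of k] that l(1) by (meson leD less_trans)
    show "Q ! k \<in> N" if "l < k" "k < s" "\<not> E (Q ! k) X" for k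
      using nN[of k] order_nth[OF X l(1) _ l(2), of k] that by (meson leD)
  qed (use l Yl \<open>0 < l\<close> \<open>Suc l < s\<close> in auto)
qed

lemma hub_path_impossible: False
proof -
  have A: "a \<in> {a, b}" and B: "b \<in> {a, b}" by auto
  have ab: "hub_pair a b" and ba: "hub_pair b a" by (auto simp: hub_pair_def)
  note cross_a = no_common_in_out[OF ab] and cross_b = no_common_in_out[OF ba]
  have type: "E a (Q ! l) \<and> E b (Q ! l) \<and> \<not> E (Q ! l) a \<and> \<not> E (Q ! l) b \<or>
      E (Q ! l) a \<and> E (Q ! l) b \<and> \<not> E a (Q ! l) \<and> \<not> E b (Q ! l)" if "l < s" "Q ! l \<notin> N" for l
    using Z_cases[OF that] cross_a[OF that(1)] cross_b[OF that(1)] by blast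
  \<comment> \<open>If \<open>N\<close> is empty, any inner position will do. Otherwise
    \<open>many_non_N\<close> gives three vertices outside \<open>N\<close>, and only two of them
    can be ends.\<close>
  have "\<exists>l. 0 < l \<and> Suc l < s \<and> Q ! l \<notin> N"
  proof (cases "N = {}")
    case True
    obtain i where i: "0 < i" "i < s" "E a (Q ! i)" using hub_index(1)[OF A] by blast
    then have "i \<noteq> s - 1" using cross_b[of i] nth_last[OF B] by auto
    then show ?thesis using i True by (intro exI[of _ i]) auto
  next
    case False
    show ?thesis
    proof (rule ccontr)
      assume none: "\<not> ?thesis"
      have "Z \<subseteq> {Q ! 0, Q ! (s - 1)}"
      proof
        fix z assume z: "z \<in> Z"
        then obtain l where l: "l < s" "z = Q ! l" using Q(3) by (metis DiffD1 in_set_conv_nth)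
        then have "l = 0 \<or> l = s - 1" using none z by force
        then show "z \<in> {Q ! 0, Q ! (s - 1)}" using l by blast
      qed
      then have "card Z \<le> card {Q ! 0, Q ! (s - 1)}" by (intro card_mono) auto
      also have "\<dots> \<le> 2" by (simp add: card_insert_if)
      finally show False using many_non_N False by simp
    qed
  qed
  then obtain l where l: "0 < l" "Suc l < s" "Q ! l \<notin> N" by blast
  obtain ia where ia: "Suc ia < s" "E (Q ! ia) a" using hub_index(2)[OF A] by blast
  obtain ob where ob: "0 < ob" "ob < s" "E b (Q ! ob)" using hub_index(1)[OF B] by blast
  from type[of l] l consider "E a (Q ! l)" "E b (Q ! l)" | "E (Q ! l) a" "E (Q ! l) b" by auto
  then show False
  proof cases
    case 1
    \<comment> \<open>The starts are common out-neighbours, so \<open>l\<close> makes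
      \<open>x\<close> positive and \<open>flex\<close> holds on the start side. The ends are
      in-neighbours of \<open>a\<close> alone, since only such an inner vertex \<open>ia\<close> is
      known.\<close>
    define P where "P = {k. k < s \<and> E a (Q ! k) \<and> E b (Q ! k)}"
    define J where "J = {k. k < s \<and> E (Q ! k) a}"
    define x where "x = Max P"
    define y where "y = Min J"
    have fin: "finite P" "finite J" by (auto simp: P_def J_def)
    have "l \<in> P" "ia \<in> J" using 1 l ia by (auto simp: P_def J_def)
    then have x: "x \<in> P" "l \<le> x" and y: "y \<in> J" "y \<le> ia"
      using fin unfolding x_def y_def by (auto intro: Max_in Min_in)
    have xs: "x < s" "E a (Q ! x)" using x by (auto simp: P_def)
    have ys: "y < s" "E (Q ! y) a" using y by (auto simp: J_def)
    have "x \<le> y" using order_nth[OF A ys(1) xs(1) ys(2) xs(2)] .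
    show False
    proof (rule no_linkage[OF ab, of "\<lambda>k. k \<in> P" "\<lambda>k. k \<in> J" x y])
      show "Q ! k \<in> N" if "k < x" "k \<notin> P" for k
        using type[of k] order_nth[OF A _ xs(1) _ xs(2), of k] that xs(1) unfolding P_def by force
      show "Q ! k \<in> N" if "x < k" "k < y" for k
      proof -
        have "k \<notin> P" "k \<notin> J" using that Max_ge[OF fin(1), of k] Min_le[OF fin(2), of k] unfolding x_def y_def by auto
        then show ?thesis using type[of k] that ys(1) unfolding P_def J_def by force
      qed
      show "Q ! k \<in> N" if "y < k" "k < s" "k \<notin> J" for k
        using type[of k] order_nth[OF A ys(1) that(2) ys(2)] that unfolding J_def by force
    qed (use x y l ia \<open>x \<le> y\<close> in \<open>auto simp: P_def J_def\<close>)
  next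
    case 2
    \<comment> \<open>The mirror case: the ends are common in-neighbours, and the starts are
      out-neighbours of \<open>b\<close> alone, with \<open>ob\<close> making \<open>x\<close>
      positive.\<close>
    define P where "P = {k. k < s \<and> E b (Q ! k)}"
    define J where "J = {k. k < s \<and> E (Q ! k) a \<and> E (Q ! k) b}"
    define x where "x = Max P"
    define y where "y = Min J"
    have fin: "finite P" "finite J" by (auto simp: P_def J_def)
    have "ob \<in> P" "l \<in> J" using 2 l ob by (auto simp: P_def J_def)
    then have x: "x \<in> P" "ob \<le> x" and y: "y \<in> J" "y \<le> l"
      using fin unfolding x_def y_def by (auto intro: Max_in Min_in)
    have xs: "x < s" "E b (Q ! x)" using x by (auto simp: P_def)
    have ys: "y < s" "E (Q ! y) a" "E (Q ! y) b" using y by (auto simp: J_def)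
    have "x \<le> y" using order_nth[OF B ys(1) xs(1) ys(3) xs(2)] .
    show False
    proof (rule no_linkage[OF ab, of "\<lambda>k. k \<in> P" "\<lambda>k. k \<in> J" x y])
      show "Q ! k \<in> N" if "k < x" "k \<notin> P" for k
        using type[of k] order_nth[OF B _ xs(1) _ xs(2), of k] that xs(1) unfolding P_def by force
      show "Q ! k \<in> N" if "x < k" "k < y" for k
      proof -
        have "k \<notin> P" "k \<notin> J" using that Max_ge[OF fin(1), of k] Min_le[OF fin(2), of k] unfolding x_def y_def by auto
        then show ?thesis using type[of k] that ys(1) unfolding P_def J_def by force
      qed
      show "Q ! k \<in> N" if "y < k" "k < s" "k \<notin> J" for k
        using type[of k] order_nth[OF A ys(1) that(2) ys(2)] that unfolding J_def by force
    qed (use x y l ob \<open>x \<le> y\<close> in \<open>auto simp: P_def J_def\<close>)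
  qed
qed

end

section \<open>The bad pair is impossible\<close>

context M_digraph
begin

lemma nonadj_sym: "nonadj x y \<Longrightarrow> nonadj y x"
  by (auto simp: nonadj_def)

text \<open>By \<open>order_on_cycle\<close> at most one vertex is both an in- and an out-neighbour
  of \<open>a\<close>, so \<open>a\<close> has at least \<open>dg a - 1\<close> distinct
  neighbours.\<close>

lemma card_nonadj_hub:
  assumes ab: "nonadj a b" and bad: "dg a + dg b + 2 \<le> 2 * card V"
    and C: "dcycle E (b # R)" "set (b # R) = V - {a}"
  shows "card {t \<in> V - {a, b}. nonadj a t} + dg a + 1 \<le> card V"
proof -
  have V: "a \<in> V" "b \<in> V" "a \<noteq> b" "\<not> E a b" "\<not> E b a" using ab by (auto simp: nonadj_def)
  have R: "set R = V - {a, b}" using C by (auto simp: dcycle_def dpath_def)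
  define X where "X = {z \<in> V. E a z}"
  define Y where "Y = {z \<in> V. E z a}"
  have fin: "finite X" "finite Y" using finite_V by (auto simp: X_def Y_def)
  have XR: "X \<subseteq> set R" "Y \<subseteq> set R" using R V E_irrefl by (auto simp: X_def Y_def)
  have "x = y" if xy: "x \<in> X \<inter> Y" "y \<in> X \<inter> Y" for x y
  proof (rule ccontr)
    assume "x \<noteq> y"
    obtain us vs where us: "R = us @ x # vs" using xy XR by (metis IntD1 split_list subsetD)
    then consider "y \<in> set us" | "y \<in> set vs" using xy XR \<open>x \<noteq> y\<close> by auto
    then show False
    proof cases
      case 1
      then have "subseq [y, x] (us @ (x # vs))" by (intro subseq_pairI) auto
      then show False using order_on_cycle[OF ab bad C, of y x] us xy by (auto simp: X_def Y_def)
    next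
      case 2
      then have "subseq [x, y] ((us @ [x]) @ vs)" by (intro subseq_pairI) auto
      then show False using order_on_cycle[OF ab bad C, of x y] us xy by (auto simp: X_def Y_def)
    qed
  qed
  then have "card (X \<inter> Y) \<le> 1" using fin by (simp add: card_le_Suc0_iff_eq)
  moreover have "card X + card Y = card (X \<union> Y) + card (X \<inter> Y)" using card_Un_Int fin by blast
  moreover have "dg a = card X + card Y" by (simp add: deg_in_def X_def Y_def)
  moreover have "card {t \<in> V - {a, b}. nonadj a t} = card (set R) - card (X \<union> Y)"
  proof -
    have "{t \<in> V - {a, b}. nonadj a t} = set R - (X \<union> Y)"
      using R V by (auto simp: nonadj_def X_def Y_def)
    then show ?thesis using XR fin card_Diff_subset[of "X \<union> Y" "set R"] by simp
  qed
  moreover have "card (X \<union> Y) \<le> card (set R)" using XR by (intro card_mono) auto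
  moreover have "card (set R) + 2 = card V"
  proof -
    have "card (set R) = card V - card {a, b}" unfolding R using V finite_V by (intro card_Diff_subset) auto
    then show ?thesis using V card_V by simp
  qed
  ultimately show ?thesis by linarith
qed

lemma deg_nonadj_le:
  assumes "nonadj a t"
  shows "dg t + 4 \<le> 2 * card V"
proof -
  have t: "a \<in> V" "t \<in> V" "a \<noteq> t" "\<not> E a t" "\<not> E t a" using assms by (auto simp: nonadj_def)
  have "dg t = deg_in E ({a, t} \<union> (V - {a, t})) t" using t by (simp add: Un_absorb1 insert_absorb)
  also have "\<dots> = deg_in E {a, t} t + deg_in E (V - {a, t}) t" using finite_V by (intro deg_in_union) auto
  also have "deg_in E {a, t} t = 0" using t E_irrefl by (intro deg_in_eq_0) auto
  also have "deg_in E (V - {a, t}) t \<le> 2 * card (V - {a, t})" using finite_V by (intro deg_in_le) auto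
  finally have "dg t \<le> 2 * card (V - {a, t})" by simp
  moreover have "card (V - {a, t}) = card V - 2" using t finite_V by (subst card_Diff_subset) auto
  ultimately show ?thesis using card_V by simp
qed

lemma M_digraph_impossible: False
proof -
  obtain a b R where ab: "nonadj a b" and bad: "dg a + dg b + 2 \<le> 2 * card V"
    and C: "dcycle E (b # R)" "set (b # R) = V - {a}"
    using exceptional_pair .
  obtain Q where Q: "dpath E Q" "Q \<noteq> []" "set Q = V - {a, b}" "E a (hd Q)" "E (last Q) a"
    using path_through_rest[OF ab bad C] .
  have V: "a \<in> V" "b \<in> V" "a \<noteq> b" using ab by (auto simp: nonadj_def)
  have ba: "nonadj b a" and bad': "dg b + dg a + 2 \<le> 2 * card V" using ab bad nonadj_sym by auto
  \<comment> \<open>Prepending the closing hub turns such a path into a cycle missing only the other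
    hub, so the results on \<open>M_digraph\<close> cycles apply with either hub left out.\<close>
  have cyc: "dcycle E (X # P)" "set (X # P) = V - {Y}"
    if "dpath E P" "P \<noteq> []" "set P = V - {a, b}" "E X (hd P)" "E (last P) X" "{X, Y} = {a, b}" for X Y P
    using that V by (auto simp: dcycle_def dpath_Cons doubleton_eq_iff)
  define Na where "Na = {t \<in> V - {a, b}. nonadj a t}"
  define Nb where "Nb = {t \<in> V - {b, a}. nonadj b t}"
  have ca: "card Na + dg a + 1 \<le> card V"
    using card_nonadj_hub[OF ab bad C] by (simp add: Na_def)
  have cb: "card Nb + dg b + 1 \<le> card V"
    using card_nonadj_hub[OF ba bad' cyc[OF Q]] by (simp add: Nb_def)
  have fin: "finite Na" "finite Nb" using finite_V by (auto simp: Na_def Nb_def)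
  have cN: "card (Na \<union> Nb) \<le> card Na + card Nb" by (rule card_Un_le)
  \<comment> \<open>\<open>M\<close> is applied to the bad pair together with the pair of
    \<open>t\<close> and its non-adjacent hub, and the hub degrees are bounded by \<open>ca\<close>
    and \<open>cb\<close>.\<close>
  have degN: "card V + card (Na \<union> Nb) + 1 \<le> dg t \<and> dg t + 4 \<le> 2 * card V" if t: "t \<in> Na \<union> Nb" for t
    using t
  proof
    assume t: "t \<in> Na"
    then have "card Na \<ge> 1" using fin by (metis One_nat_def Suc_leI card_gt_0_iff empty_iff)
    moreover have at: "nonadj a t" "{a, b} \<noteq> {a, t}" using t by (auto simp: Na_def doubleton_eq_iff)
    ultimately show ?thesis using M[OF ab at] deg_nonadj_le[OF at(1)] ca cb cN by linarith
  next
    assume t: "t \<in> Nb"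
    then have "card Nb \<ge> 1" using fin by (metis One_nat_def Suc_leI card_gt_0_iff empty_iff)
    moreover have bt: "nonadj b t" "{a, b} \<noteq> {b, t}" using t by (auto simp: Nb_def doubleton_eq_iff)
    ultimately show ?thesis using M[OF ab bt] deg_nonadj_le[OF bt(1)] ca cb cN by linarith
  qed
  interpret hub_digraph V E a b "Na \<union> Nb"
  proof unfold_locales
    \<comment> \<open>The two bounds on \<open>dg t\<close> leave at least five vertices outside
      \<open>Na \<union> Nb\<close>, two of which are the hubs.\<close>
    show "Na \<union> Nb = {} \<or> 3 \<le> card (V - {a, b} - (Na \<union> Nb))"
    proof (cases "Na \<union> Nb = {}")
      case False
      then obtain t where "t \<in> Na \<union> Nb" by blast
      then have "card (Na \<union> Nb) + 5 \<le> card V" using degN[of t] by linarith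
      moreover have "card (V - {a, b} - (Na \<union> Nb)) = card (V - {a, b}) - card (Na \<union> Nb)"
        using fin by (intro card_Diff_subset) (auto simp: Na_def Nb_def)
      moreover have "card (V - {a, b}) = card V - 2" using V finite_V by (subst card_Diff_subset) auto
      ultimately show ?thesis by linarith
    qed simp
    show "\<not> subseq [x, y] P"
      if "dpath E P" "P \<noteq> []" "set P = V - {a, b}" "E b (hd P)" "E (last P) b" "E x a" "E a y" for P x y
      using order_on_cycle[OF ab bad cyc[OF that(1-5)] that(6,7)] by auto
    show "\<not> subseq [x, y] P"
      if "dpath E P" "P \<noteq> []" "set P = V - {a, b}" "E a (hd P)" "E (last P) a" "E x b" "E b y" for P x y
      using order_on_cycle[OF ba bad' cyc[OF that(1-5)] that(6,7)] by auto
    show "card V + card (Na \<union> Nb) + 1 \<le> dg t" if "t \<in> Na \<union> Nb" for t using degN[OF that] by blast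
    show "(E a z \<or> E z a) \<and> (E b z \<or> E z b)" if "z \<in> V - {a, b} - (Na \<union> Nb)" for z
      using that V by (auto simp: Na_def Nb_def nonadj_def)
    show "\<not> E a t \<and> \<not> E t a \<or> \<not> E b t \<and> \<not> E t b" if "t \<in> Na \<union> Nb" for t
      using that by (auto simp: Na_def Nb_def nonadj_def)
  qed (use card_V strong_del not_ham ab in \<open>auto simp: Na_def Nb_def\<close>)
  obtain Q' where Q': "dpath E Q'" "Q' \<noteq> []" "set Q' = V - {a, b}" "E a (hd Q')" "E b (hd Q')"
    "E (last Q') a" "E (last Q') b"
    using good_path[OF Q] .
  interpret hub_path V E a b "Na \<union> Nb" Q'
    by unfold_locales (use Q' in auto)
  show False by (rule hub_path_impossible)
qed

end

section \<open>Transfer to digraphs with arcs\<close>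

context digraph
begin

abbreviation arc_rel :: "'a \<Rightarrow> 'a \<Rightarrow> bool" where "arc_rel u v \<equiv> u \<rightarrow>\<^bsub>G\<^esub> v"

lemma arc_relE: "arc_rel u v \<Longrightarrow> \<exists>e\<in>arcs G. tail G e = u \<and> head G e = v"
  by (auto simp: arcs_ends_def arc_to_ends_def)

lemma rel_digraph_arcs: "rel_digraph (verts G) arc_rel"
proof
  show "\<not> arc_rel x x" for x using arc_relE[of x x] no_loops by metis
qed (auto dest: arc_relE)

text \<open>Without multiple arcs, \<open>head\<close> is injective on the arcs leaving
  \<open>x\<close> and \<open>tail\<close> on those entering it, so counting arcs is counting
  neighbours.\<close>

lemma degree_conv: "degree G x = deg_in arc_rel (verts G) x"
proof -
  have 1: "inj_on (head G) (out_arcs G x)" "inj_on (tail G) (in_arcs G x)"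
    by (auto intro!: inj_onI no_multi_arcs simp: arc_to_ends_def)
  have 2: "head G ` out_arcs G x = {z \<in> verts G. arc_rel x z}" "tail G ` in_arcs G x = {z \<in> verts G. arc_rel z x}"
    by (force simp: arcs_ends_def arc_to_ends_def)+
  show ?thesis
    unfolding degree_def out_degree_def in_degree_def deg_in_def 2[symmetric]
    using card_image[OF 1(1)] card_image[OF 1(2)] by simp
qed

text \<open>A walk from a vertex of \<open>S\<close> to a vertex of \<open>U - S\<close> has an arc
  crossing from one to the other.\<close>

lemma strongly_connected_out_closed_free:
  assumes "strongly_connected (G \<restriction> U)"
  shows "rel_digraph.out_closed_free arc_rel U"
  unfolding rel_digraph.out_closed_free_def[OF rel_digraph_arcs]
proof (intro allI impI)
  fix S assume S: "S \<subseteq> U \<and> S \<noteq> {} \<and> S \<noteq> U"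
  then obtain x y where xy: "x \<in> S" "y \<in> U - S" by blast
  then have "(x, y) \<in> rtrancl_on U (arcs_ends (G \<restriction> U))"
    using assms S by (auto simp: strongly_connected_def reachable_def)
  then have "y \<in> S \<or> (\<exists>u\<in>S. \<exists>v\<in>U - S. arc_rel u v)"
  proof (induction rule: rtrancl_on_induct)
    case base
    then show ?case using xy by blast
  next
    case (step u v)
    moreover from this have "arc_rel u v" by (auto simp: arcs_ends_def arc_to_ends_def)
    ultimately show ?case by blast
  qed
  then show "\<exists>u\<in>S. \<exists>v\<in>U - S. arc_rel u v" using xy by blast
qed

lemma awalk_of_vertices:
  assumes "successively arc_rel (x # xs)" "x \<in> verts G"
  shows "\<exists>p. awalk x p (last (x # xs)) \<and> awalk_verts x p = x # xs"
  using assms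
proof (induction xs arbitrary: x)
  case Nil
  then show ?case by (intro exI[of _ "[]"]) (simp add: awalk_Nil_iff)
next
  case (Cons y ys)
  then obtain e where e: "e \<in> arcs G" "tail G e = x" "head G e = y"
    using arc_relE[of x y] by (auto simp: successively_Cons)
  moreover from this have "y \<in> verts G" by auto
  ultimately obtain p where "awalk y p (last (y # ys))" "awalk_verts y p = y # ys"
    using Cons by (auto simp: successively_Cons)
  then show ?case using e by (intro exI[of _ "e # p"]) (auto simp: awalk_Cons_iff)
qed

lemma hamiltonian_if_dcycle:
  assumes "dcycle arc_rel C" "set C = verts G"
  shows "hamiltonian G"
proof -
  obtain c cs where C: "C = c # cs" using assms(1) by (cases C) (auto simp: dcycle_def)
  \<comment> \<open>The closed walk lists \<open>c\<close> at both ends; \<open>cycle\<close>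
    demands distinctness only of the tail of this list.\<close>
  have "successively arc_rel (c # (cs @ [c]))"
    using assms(1) unfolding C dcycle_def dpath_def by (auto simp: successively_append_iff simp flip: append_Cons)
  then obtain p where p: "awalk c p c" "awalk_verts c p = c # cs @ [c]"
    using awalk_of_vertices[of c "cs @ [c]"] assms(2) C by auto
  then have "p \<noteq> []" by (auto simp: awalk_verts.simps)
  moreover have "distinct (tl (awalk_verts c p))" using p(2) assms(1) by (auto simp: C dcycle_def dpath_def)
  ultimately have "cycle p" using p(1) unfolding cycle_def by blast
  moreover have "set (awalk_verts c p) = verts G" using p(2) assms(2) C by auto
  ultimately show ?thesis unfolding hamiltonian_def by blast
qed

end

theorem theorem1p12:
  fixes D :: "('a, 'b) pre_digraph"
  assumes "digraph D"
    and "card (verts D) \<ge> 3"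
    and "k_strong 2 D"
    and "condition_M D"
  shows "hamiltonian D"
proof (rule ccontr)
  assume non_ham: "\<not> hamiltonian D"
  interpret digraph D by fact
  interpret R: rel_digraph "verts D" "arc_rel" by (rule rel_digraph_arcs)
  have strong: "R.out_closed_free (verts D - X)" if "X \<subseteq> verts D" "card X < 2" for X
    using assms(3) that by (intro strongly_connected_out_closed_free) (simp add: k_strong_def)
  have nonadj: "R.nonadj x y \<longleftrightarrow> nonadjacent_pair D x y" for x y
    by (auto simp: R.nonadj_def nonadjacent_pair_def adjacent_def)
  interpret M_digraph "verts D" arc_rel
  proof unfold_locales
    show "R.out_closed_free (verts D)" using strong[of "{}"] by simp
    show "R.out_closed_free (verts D - {v})" if "v \<in> verts D" for v using strong[of "{v}"] that by simp
    show "4 * card (verts D) \<le> R.dg x + R.dg y + R.dg w + R.dg z + 3"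
      if "R.nonadj x y" "R.nonadj w z" "{x, y} \<noteq> {w, z}" for x y w z
    proof -
      have "degree D x + degree D y + degree D w + degree D z \<ge> 4 * card (verts D) - 3"
        using assms(4) that unfolding condition_M_def nonadj by blast
      then show ?thesis unfolding degree_conv by linarith
    qed
    show "\<not> (dcycle arc_rel C \<and> set C = verts D)" for C
      using hamiltonian_if_dcycle non_ham by blast
  qed (rule assms(2))
  show False by (rule M_digraph_impossible)
qed

end
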